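(* There is a seeded aTAM system at temperature $2$ which strictly self-assembles the discrete self-similar fractal $K^\infty$ (the "Sierpinski Cacarpet"), i.e. every terminal production of this system has domain exactly $K^\infty$.
   Context: Directions: $N=(0,1)$, $E=(1,0)$, $S=(0,-1)$, $W=(-1,0)$. aTAM: a tile type is a map $t:\{N,E,S,W\}\to\Sigma$ ($t(d)$ is the glue on side $d$). A seeded Tile Assembly System consists of a finite set of tile types, a strength function $\mathrm{str}:\Sigma\to\mathbb{Z}$, a temperature $\tau\in\mathbb{N}$ and a seed assembly. An assembly is a partial map $A:\mathbb{Z}^2\rightharpoonup T$. For adjacent positions $z,z+d$ in $\mathrm{dom}(A)$, the binding strength of the edge between them is $\mathrm{str}(g)$ if $A(z)(d)=A(z+d)(-d)=g$, and $0$ otherwise. $A$ is stable if every cut of the grid graph on $\mathrm{dom}(A)$ (partition of $\mathrm{dom}(A)$ into two nonempty parts) has total binding strength at least $\tau$. An attachment adds one tile at a position not in $\mathrm{dom}(A)$ such that the resulting assembly is stable. A production is an assembly obtained from the seed by a finite or infinite sequence of attachments (taking the union in the infinite case); it is terminal if no attachment is possible. The system strictly self-assembles $X\subseteq\mathbb{Z}^2$ if every terminal production has domain exactly $X$. Substitutions: for a finite $G\subset\mathbb{N}^2$ with $(0,0)\in G$, let $w=1+\max\{x:(x,y)\in G\}$, $h=1+\max\{y:(x,y)\in G\}$, and for $p=(x,y)$ let $\lfloor p/G\rfloor=(\lfloor x/w\rfloor,\lfloor y/h\rfloor)$ and $p\bmod G=(x\bmod w,y\bmod h)$. Define $\sigma_G(X)=\{p\in\mathbb{N}^2:\lfloor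 p/G\rfloor\in X,\ p\bmod G\in G\}$, $G^k=\sigma_G^k(\{(0,0)\})$, $G^\infty=\bigcup_{k}G^k$. Here $K=\{0,\dots,5\}^2\setminus\{2,3\}^2$. *)

theory Defs
  imports Main
begin

datatype dir = N | E | S | W

type_synonym pos = "int \<times> int"

fun dvec :: "dir \<Rightarrow> pos" where
  "dvec N = (0, 1)"
| "dvec E = (1, 0)"
| "dvec S = (0, -1)"
| "dvec W = (-1, 0)"

fun opp :: "dir \<Rightarrow> dir" where
  "opp N = S" | "opp E = W" | "opp S = N" | "opp W = E"

definition padd :: "pos \<Rightarrow> pos \<Rightarrow> pos" where
  "padd p q = (fst p + fst q, snd p + snd q)"

text \<open>Glues are natural numbers (any finite glue alphabet can be encoded).
  A tile type maps each side to its glue; an assembly is a partial map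
  from positions to tile types.\<close>

type_synonym tile = "dir \<Rightarrow> nat"
type_synonym assembly = "pos \<rightharpoonup> tile"

definition edge_strength :: "(nat \<Rightarrow> int) \<Rightarrow> assembly \<Rightarrow> pos \<Rightarrow> dir \<Rightarrow> int" where
  "edge_strength str A z d =
     (case (A z, A (padd z (dvec d))) of
        (Some t1, Some t2) \<Rightarrow> (if t1 d = t2 (opp d) then str (t1 d) else 0)
      | _ \<Rightarrow> 0)"

text \<open>Edges crossing the cut (P, dom A - P), each represented once as (z,d) with z in P.\<close>
definition cut_edges :: "assembly \<Rightarrow> pos set \<Rightarrow> (pos \<times> dir) set" where
  "cut_edges A P = {(z, d). z \<in> P \<and> padd z (dvec d) \<in> dom A - P}"

text \<open>Total binding strength of a cut is at least tau.  For finitely many crossing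
  edges this is exactly the finite sum; in general it says the net of finite
  partial sums is eventually at least tau.\<close>
definition cut_ge :: "(nat \<Rightarrow> int) \<Rightarrow> int \<Rightarrow> assembly \<Rightarrow> pos set \<Rightarrow> bool" where
  "cut_ge str \<tau> A P =
     (\<exists>F0. finite F0 \<and> F0 \<subseteq> cut_edges A P \<and>
        (\<forall>F. finite F \<and> F0 \<subseteq> F \<and> F \<subseteq> cut_edges A P \<longrightarrow>
              \<tau> \<le> (\<Sum>(z, d)\<in>F. edge_strength str A z d)))"

definition stable :: "(nat \<Rightarrow> int) \<Rightarrow> nat \<Rightarrow> assembly \<Rightarrow> bool" where
  "stable str \<tau> A =
     (\<forall>P. P \<subseteq> dom A \<and> P \<noteq> {} \<and> dom A - P \<noteq> {} \<longrightarrow> cut_ge str (int \<tau>) A P)"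

record tas =
  tiles :: "tile set"
  strength :: "nat \<Rightarrow> int"
  temp :: nat
  seed :: assembly

definition valid_tas :: "tas \<Rightarrow> bool" where
  "valid_tas \<T> =
     (finite (tiles \<T>) \<and> finite (dom (seed \<T>)) \<and> dom (seed \<T>) \<noteq> {} \<and>
      ran (seed \<T>) \<subseteq> tiles \<T> \<and> stable (strength \<T>) (temp \<T>) (seed \<T>))"

definition attaches :: "tas \<Rightarrow> assembly \<Rightarrow> assembly \<Rightarrow> bool" where
  "attaches \<T> A B =
     (\<exists>z t. z \<notin> dom A \<and> t \<in> tiles \<T> \<and> B = A(z \<mapsto> t) \<and>
            stable (strength \<T>) (temp \<T>) (A(z \<mapsto> t)))"

text \<open>A production: union of a finite or infinite attachment sequence starting at the
  seed (stuttering steps f (Suc n) = f n encode finite sequences).\<close>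
definition production :: "tas \<Rightarrow> assembly \<Rightarrow> bool" where
  "production \<T> A =
     (\<exists>f :: nat \<Rightarrow> assembly.
        f 0 = seed \<T> \<and>
        (\<forall>n. f (Suc n) = f n \<or> attaches \<T> (f n) (f (Suc n))) \<and>
        (\<forall>z. (A z = None \<longleftrightarrow> (\<forall>n. f n z = None)) \<and>
             (\<forall>n. f n z \<noteq> None \<longrightarrow> A z = f n z)))"

definition terminal_production :: "tas \<Rightarrow> assembly \<Rightarrow> bool" where
  "terminal_production \<T> A = (production \<T> A \<and> (\<nexists>B. attaches \<T> A B))"

definition strictly_self_assembles :: "tas \<Rightarrow> pos set \<Rightarrow> bool" where
  "strictly_self_assembles \<T> X = (\<forall>A. terminal_production \<T> A \<longrightarrow> dom A = X)"

definition sub_w :: "(nat \<times> nat) set \<Rightarrow> nat" where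
  "sub_w G = 1 + Max (fst ` G)"

definition sub_h :: "(nat \<times> nat) set \<Rightarrow> nat" where
  "sub_h G = 1 + Max (snd ` G)"

definition sigma :: "(nat \<times> nat) set \<Rightarrow> (nat \<times> nat) set \<Rightarrow> (nat \<times> nat) set" where
  "sigma G X = {(x, y). (x div sub_w G, y div sub_h G) \<in> X \<and>
                        (x mod sub_w G, y mod sub_h G) \<in> G}"

definition G_pow :: "(nat \<times> nat) set \<Rightarrow> nat \<Rightarrow> (nat \<times> nat) set" where
  "G_pow G k = (sigma G ^^ k) {(0, 0)}"

definition G_inf :: "(nat \<times> nat) set \<Rightarrow> (nat \<times> nat) set" where
  "G_inf G = (\<Union>k. G_pow G k)"

definition K :: "(nat \<times> nat) set" where
  "K = ({0..5} \<times> {0..5}) - ({2, 3} \<times> {2, 3})"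

definition to_pos :: "nat \<times> nat \<Rightarrow> pos" where
  "to_pos p = (int (fst p), int (snd p))"

end

theory Submission
  imports Defs
begin

text \<open>
  Cells are glued to their western and southern neighbours, so that the carpet grows towards the
  north-east.  This cannot work everywhere: a cell on the eastern wall of a hole would have a southern
  input only, so the wall would be eventually periodic and could not notice where the hole ends.
  Therefore, in a block of side 6^k that has a southern but no western neighbour block, the topmost
  row grows westwards from its eastern end, where the extent of the block is known; transposed, in a
  block that has a western but no southern neighbour, the last column grows southwards.

  What a cell must know concerns the blocks containing it, on all levels, and has to be spread so
  that every glue carries a bounded amount.  The address of a block in its parent block travels along
  row 1 and column 1 of the block; whatever the block, regarded as a single cell, sends to its
  neighbours travels along its row 4 and column 4.  Iterating this, the wires of level k run on the
  lines whose last base-6 digits are 1 4 ... 4, so that no line carries two wires.  Where row 4 meets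
  column 4, the block has to act as a cell does and needs its address for that; it is brought there
  through columns 0 and 4.  The addresses are also sent along row 5 and column 5 to the
  north-east corner of the block, where they tell whether a hole or a reversed line is adjacent.
\<close>

section \<open>Growth plans\<close>

text \<open>Every glue carries the whole state of the cell that emits it. What is wanted is
  therefore a state with finitely many values that each cell can compute from its inputs. Two
  obstacles shape it. A glue fixes its strength before the receiving cell exists: the emitter must
  foresee whether that cell belongs to the set and how many inputs it will have, because a sole
  input needs strength 2 and each of two inputs strength 1. So the state contains flags about
  neighbours that are still missing. Moreover, reversed lines carry information against the general
  direction of growth, and a rank has to show that no cell waits for itself. Wires and reversals are
  defined globally, by recursion on the base-6 digits of the coordinates; that local rules reproduce
  them is shown by passing from a cell to the block containing it.\<close>

lemma UNIV_dir: "(UNIV :: dir set) = {N, E, S, W}"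
proof -
  have "d \<in> {N, E, S, W}" for d by (cases d) auto
  then show ?thesis by auto
qed

lemma finite_dir_set [simp]: "finite (A :: dir set)"
  by (rule finite_subset[OF subset_UNIV]) (simp add: UNIV_dir)

lemma finite_fun_dir:
  assumes "finite B"
  shows "finite {f :: dir \<Rightarrow> 'b. \<forall>d. f d \<in> B}"
proof -
  have "inj_on (\<lambda>f. (f N, f E, f S, f W)) {f :: dir \<Rightarrow> 'b. \<forall>d. f d \<in> B}"
    by (auto simp: inj_on_def fun_eq_iff) (metis dir.exhaust)
  moreover have "(\<lambda>f. (f N, f E, f S, f W)) ` {f :: dir \<Rightarrow> 'b. \<forall>d. f d \<in> B} \<subseteq> B \<times> B \<times> B \<times> B"
    by auto
  ultimately show ?thesis
    using assms by (meson finite_SigmaI finite_imageD finite_subset)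
qed

lemma opp_opp [simp]: "opp (opp d) = d"
  by (cases d) auto

lemma opp_neq [simp]: "opp d \<noteq> d" "d \<noteq> opp d"
  by (cases d; simp)+

lemma padd_opp [simp]: "padd (padd z (dvec d)) (dvec (opp d)) = z"
  by (cases d) (auto simp: padd_def)

lemma padd_neq [simp]: "padd z (dvec d) \<noteq> z"
  by (cases d; cases z) (auto simp: padd_def)

lemma padd_inj: "padd z (dvec d) = padd z (dvec d') \<longleftrightarrow> d = d'"
  by (cases d; cases d') (auto simp: padd_def)

text \<open>The receiving cell determines the strength, so the emitter has to know the number of
  inputs of its neighbour.\<close>

definition out_strength :: "pos set \<Rightarrow> (pos \<Rightarrow> dir set) \<Rightarrow> pos \<Rightarrow> dir \<Rightarrow> nat" where
  "out_strength X I z d = (if padd z (dvec d) \<in> X \<and> opp d \<in> I (padd z (dvec d))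
     then 2 div card (I (padd z (dvec d))) else 0)"

text \<open>A growth plan assigns to every cell of \<open>X\<close> the sides from which it is to be glued and a state
  that it broadcasts to the cells glued to it.  A cell waits for all its inputs, because each of its
  \<open>k\<close> input glues has strength \<open>2 div k\<close>.\<close>

locale growth_plan =
  fixes X :: "pos set" and z0 :: pos and I :: "pos \<Rightarrow> dir set" and s :: "pos \<Rightarrow> 's"
    and rank :: "pos \<Rightarrow> nat"
  assumes z0: "z0 \<in> X" "I z0 = {}"
    and card_I: "\<lbrakk>z \<in> X; z \<noteq> z0\<rbrakk> \<Longrightarrow> card (I z) = 1 \<or> card (I z) = 2"
    and I_closed: "\<lbrakk>z \<in> X; d \<in> I z\<rbrakk> \<Longrightarrow> padd z (dvec d) \<in> X"
    and rank: "\<lbrakk>z \<in> X; d \<in> I z\<rbrakk> \<Longrightarrow> rank (padd z (dvec d)) < rank z"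
    and fin: "finite (s ` X)"
    and state_determined: "\<lbrakk>z \<in> X; z' \<in> X; z \<noteq> z0; z' \<noteq> z0; I z = I z';
          \<forall>d \<in> I z. s (padd z (dvec d)) = s (padd z' (dvec d))\<rbrakk> \<Longrightarrow> s z = s z'"
    and out_determined: "\<lbrakk>z \<in> X; z' \<in> X; s z = s z'\<rbrakk> \<Longrightarrow> out_strength X I z = out_strength X I z'"
begin

abbreviation "out \<equiv> out_strength X I"

section \<open>The tile system of a growth plan\<close>

definition glues :: "('s \<times> dir \<times> nat) set" where
  "glues = (s ` X) \<times> UNIV \<times> {1, 2}"

definition number :: "'s \<times> dir \<times> nat \<Rightarrow> nat" where
  "number = (SOME f. inj_on f glues)"

text \<open>Glue 0 is kept free for sides that bind nothing.\<close>

definition enc :: "'s \<times> dir \<times> nat \<Rightarrow> nat" where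
  "enc g = Suc (number g)"

definition str :: "nat \<Rightarrow> int" where
  "str n = (case n of 0 \<Rightarrow> 0 | Suc m \<Rightarrow> int (snd (snd (inv_into glues number m))))"

definition tile_at :: "pos \<Rightarrow> tile" where
  "tile_at z d = (if d \<in> I z then enc (s (padd z (dvec d)), opp d, 2 div card (I z))
                  else if 0 < out z d then enc (s z, d, out z d) else 0)"

definition sys :: tas where
  "sys = \<lparr>tiles = tile_at ` X, strength = str, temp = 2, seed = [z0 \<mapsto> tile_at z0]\<rparr>"

text \<open>The invariant of growth: every stage, and also the union, is \<open>restr D\<close> for
  such a \<open>D\<close>.\<close>

definition closed :: "pos set \<Rightarrow> bool" where
  "closed D \<longleftrightarrow> D \<subseteq> X \<and> z0 \<in> D \<and> (\<forall>z \<in> D. \<forall>d \<in> I z. padd z (dvec d) \<in> D)"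

definition restr :: "pos set \<Rightarrow> assembly" where
  "restr D = (\<lambda>z. if z \<in> D then Some (tile_at z) else None)"

lemma dom_restr [simp]: "dom (restr D) = D"
  by (auto simp: restr_def split: if_splits)

lemma finite_glues: "finite glues"
  by (auto simp: glues_def fin)

lemma inj_number: "inj_on number glues"
proof -
  have "\<exists>f :: _ \<Rightarrow> nat. inj_on f glues"
    using finite_imp_inj_to_nat_seg[OF finite_glues] by blast
  then show ?thesis unfolding number_def by (rule someI_ex)
qed

lemma enc_eq: "\<lbrakk>g \<in> glues; h \<in> glues\<rbrakk> \<Longrightarrow> enc g = enc h \<longleftrightarrow> g = h"
  using inj_number by (auto simp: enc_def inj_on_def)

lemma str_enc: "(u, d, k) \<in> glues \<Longrightarrow> str (enc (u, d, k)) = int k"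
  by (simp add: str_def enc_def inj_number)

lemma str_0 [simp]: "str 0 = 0" and str_nonneg: "0 \<le> str n"
  by (auto simp: str_def split: nat.splits)

lemma enc_neq_0 [simp]: "enc g \<noteq> 0" "0 \<noteq> enc g"
  by (simp_all add: enc_def)

lemma I_nonempty: "\<lbrakk>z \<in> X; d \<in> I z\<rbrakk> \<Longrightarrow> z \<noteq> z0"
  using z0 by auto

lemma not_both: "\<lbrakk>z \<in> X; d \<in> I z\<rbrakk> \<Longrightarrow> opp d \<notin> I (padd z (dvec d))"
  using rank[of z d] rank[of "padd z (dvec d)" "opp d"] I_closed[of z d] by auto

lemma out_input: "\<lbrakk>z \<in> X; d \<in> I z\<rbrakk> \<Longrightarrow> out (padd z (dvec d)) (opp d) = 2 div card (I z)"
  by (simp add: out_strength_def)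

text \<open>The input strengths add up to exactly the temperature: all inputs together suffice, and
  none can be missing.\<close>

lemma input_strength: "\<lbrakk>z \<in> X; z \<noteq> z0\<rbrakk> \<Longrightarrow> 2 div card (I z) \<in> {1, 2} \<and> card (I z) * (2 div card (I z)) = 2"
  using card_I[of z] by auto

lemma out_range: "out z d \<noteq> 0 \<Longrightarrow> out z d \<in> {1, 2}"
  using input_strength I_nonempty by (auto simp: out_strength_def split: if_splits)

lemma glue_in: "\<lbrakk>z \<in> X; d \<in> I z\<rbrakk> \<Longrightarrow> (s (padd z (dvec d)), opp d, 2 div card (I z)) \<in> glues"
  using input_strength[of z] I_nonempty[of z d] I_closed[of z d] by (auto simp: glues_def)

lemma glue_out: "\<lbrakk>z \<in> X; 0 < out z d\<rbrakk> \<Longrightarrow> (s z, d, out z d) \<in> glues"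
  using out_range[of z d] by (auto simp: glues_def)

lemma finite_tiles: "finite (tile_at ` X)"
proof (rule finite_subset)
  have "tile_at z d \<in> insert 0 (enc ` glues)" if "z \<in> X" for z d
    using glue_in[OF that, of d] glue_out[OF that, of d] by (simp add: tile_at_def)
  then show "tile_at ` X \<subseteq> {f. \<forall>d. f d \<in> insert 0 (enc ` glues)}"
    by (intro image_subsetI CollectI allI)
  show "finite {f :: dir \<Rightarrow> nat. \<forall>d. f d \<in> insert 0 (enc ` glues)}"
    by (intro finite_fun_dir) (simp add: finite_glues)
qed

lemma edge_in:
  assumes "closed D" "z \<in> D" "d \<in> I z"
  shows "edge_strength str (restr D) z d = int (2 div card (I z))"
    and "edge_strength str (restr D) (padd z (dvec d)) (opp d) = int (2 div card (I z))"
proof -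
  have zX: "z \<in> X" and nb: "padd z (dvec d) \<in> D" using assms by (auto simp: closed_def)
  have t1: "tile_at z d = enc (s (padd z (dvec d)), opp d, 2 div card (I z))"
    using assms by (simp add: tile_at_def)
  have t2: "tile_at (padd z (dvec d)) (opp d) = enc (s (padd z (dvec d)), opp d, 2 div card (I z))"
    using not_both[OF zX assms(3)] out_input[OF zX assms(3)] input_strength[OF zX I_nonempty[OF zX assms(3)]]
    by (auto simp: tile_at_def)
  have cell_state: "str (enc (s (padd z (dvec d)), opp d, 2 div card (I z))) = int (2 div card (I z))"
    by (rule str_enc[OF glue_in[OF zX assms(3)]])
  show "edge_strength str (restr D) z d = int (2 div card (I z))"
    using assms(2) nb t1 t2 cell_state by (simp add: edge_strength_def restr_def)
  show "edge_strength str (restr D) (padd z (dvec d)) (opp d) = int (2 div card (I z))"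
    using assms(2) nb t1 t2 cell_state by (simp add: edge_strength_def restr_def)
qed

lemma edge_nonneg: "0 \<le> edge_strength str A z d"
  by (auto simp: edge_strength_def str_nonneg split: option.split)

text \<open>In any cut, the cell of least rank on the side without the seed has all its inputs across the cut.\<close>

lemma stable_restr:
  assumes D: "closed D"
  shows "stable str 2 (restr D)"
  unfolding stable_def
proof (intro allI impI)
  fix P assume P: "P \<subseteq> dom (restr D) \<and> P \<noteq> {} \<and> dom (restr D) - P \<noteq> {}"
  define R where "R = (if z0 \<in> P then D - P else P)"
  have R: "R \<subseteq> D" "R \<noteq> {}" "z0 \<notin> R" using P by (auto simp: R_def)
  obtain z where z: "z \<in> R" and zmin: "\<And>y. y \<in> R \<Longrightarrow> rank z \<le> rank y"
    using R(2) ex_has_least_nat[of "\<lambda>z. z \<in> R" _ rank] by blast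
  have zD: "z \<in> D" and zX: "z \<in> X" and zz0: "z \<noteq> z0"
    using z R D by (auto simp: closed_def)
  have nb: "padd z (dvec d) \<in> D - R" if "d \<in> I z" for d
    using that D zD rank[OF zX that] zmin[of "padd z (dvec d)"] by (auto simp: closed_def)
  \<comment> \<open>\<open>cut_edges\<close> names an edge by its end in \<open>P\<close>, so the
    input edges of \<open>z\<close> are named from \<open>z\<close> or from its neighbours,
    according to the side of \<open>z\<close>.\<close>
  define F0 where "F0 = (if z \<in> P then (\<lambda>d. (z, d)) ` I z else (\<lambda>d. (padd z (dvec d), opp d)) ` I z)"
  have sub: "F0 \<subseteq> cut_edges (restr D) P"
  proof (cases "z \<in> P")
    case True
    then have "R = P" using z by (auto simp: R_def split: if_splits)
    then show ?thesis using True nb by (auto simp: F0_def cut_edges_def)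
  next
    case False
    then have "R = D - P" using z by (auto simp: R_def split: if_splits)
    then show ?thesis using False nb zD by (fastforce simp: F0_def cut_edges_def)
  qed
  have sum0: "(\<Sum>(y, d)\<in>F0. edge_strength str (restr D) y d) = 2"
  proof -
    have "(\<Sum>(y, d)\<in>F0. edge_strength str (restr D) y d) = (\<Sum>d\<in>I z. int (2 div card (I z)))"
    proof (cases "z \<in> P")
      case True
      then show ?thesis unfolding F0_def
        by (auto simp: sum.reindex inj_on_def edge_in[OF D zD] intro!: sum.cong)
    next
      case False
      then show ?thesis unfolding F0_def
        by (auto simp: sum.reindex inj_on_def padd_inj edge_in[OF D zD] intro!: sum.cong)
    qed
    also have "\<dots> = int (card (I z) * (2 div card (I z)))" by simp
    also have "\<dots> = 2" using input_strength[OF zX zz0] by simp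
    finally show ?thesis .
  qed
  show "cut_ge str (int 2) (restr D) P"
    unfolding cut_ge_def
  proof (intro exI[of _ F0] conjI allI impI)
    show "finite F0" by (simp add: F0_def)
    show "F0 \<subseteq> cut_edges (restr D) P" by (rule sub)
    fix F assume F: "finite F \<and> F0 \<subseteq> F \<and> F \<subseteq> cut_edges (restr D) P"
    have "(\<Sum>(y, d)\<in>F0. edge_strength str (restr D) y d) \<le> (\<Sum>(y, d)\<in>F. edge_strength str (restr D) y d)"
      using F by (intro sum_mono2) (auto simp: edge_nonneg)
    then show "int 2 \<le> (\<Sum>(y, d)\<in>F. edge_strength str (restr D) y d)"
      using sum0 by simp
  qed
qed

text \<open>A tile made for \<open>y\<close> is tried at \<open>z\<close>. Glues record the
  direction from emitter to receiver, so an output side of \<open>y\<close> cannot match an input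
  side of \<open>z\<close>; the recorded strength gives away the number of inputs. Hence both cells
  have the same inputs in the same states.\<close>

lemma tile_at_eqI:
  assumes "z \<in> X" "y \<in> X" "z \<noteq> z0" "y \<noteq> z0"
    and I_sub: "\<And>d. d \<in> I z \<Longrightarrow> tile_at y d = tile_at z d"
  shows "tile_at y = tile_at z"
proof -
  have key: "d \<in> I y \<and> s (padd y (dvec d)) = s (padd z (dvec d)) \<and> 2 div card (I y) = 2 div card (I z)"
    if d: "d \<in> I z" for d
  proof -
    have e: "tile_at y d = enc (s (padd z (dvec d)), opp d, 2 div card (I z))"
      using I_sub[OF d] d by (simp add: tile_at_def)
    have g: "(s (padd z (dvec d)), opp d, 2 div card (I z)) \<in> glues"
      by (rule glue_in[OF assms(1) d])
    show ?thesis
    proof (cases "d \<in> I y")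
      case True
      then show ?thesis
        using e enc_eq[OF glue_in[OF assms(2) True] g] by (simp add: tile_at_def)
    next
      case False
      then have "0 < out y d" using e by (auto simp: tile_at_def split: if_splits)
      then show ?thesis
        using False e enc_eq[OF glue_out[OF assms(2)] g] by (simp add: tile_at_def)
    qed
  qed
  have "I z \<noteq> {}" using card_I[OF assms(1,3)] by auto
  then have "card (I y) = card (I z)"
    using key card_I[OF assms(1,3)] card_I[OF assms(2,4)] by fastforce
  moreover have "I z \<subseteq> I y" using key by auto
  ultimately have I: "I z = I y" by (simp add: card_subset_eq)
  then have "s y = s z"
    using key state_determined[OF assms(2,1) assms(4,3)] by auto
  then show ?thesis
    using I key out_determined[OF assms(2,1)] by (auto simp: tile_at_def fun_eq_iff)
qed

text \<open>Only the cut around the new tile is used. Every glue that can bind there was emitted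
  towards \<open>z\<close> as an input, and strength 2 is reached only if all inputs of
  \<open>z\<close> are present and matched.\<close>

lemma attach_step:
  assumes D: "closed D" and att: "attaches sys (restr D) B"
  shows "\<exists>D'. closed D' \<and> B = restr D'"
proof -
  obtain z t where z: "z \<notin> D" and t: "t \<in> tile_at ` X" and B: "B = (restr D)(z \<mapsto> t)"
    and cell_state: "stable str 2 B"
    using att by (auto simp: attaches_def sys_def)
  have domB: "dom B = insert z D" by (simp add: B)
  have "z0 \<in> D" using D by (simp add: closed_def)
  then have "cut_ge str (int 2) B {z}"
    using cell_state z unfolding stable_def domB by auto
  moreover have ce: "cut_edges B {z} = (\<lambda>d. (z, d)) ` {d. padd z (dvec d) \<in> D}"
    by (auto simp: cut_edges_def domB)
  ultimately have "2 \<le> (\<Sum>(y, d)\<in>cut_edges B {z}. edge_strength str B y d)"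
    unfolding cut_ge_def by auto
  also have "\<dots> = (\<Sum>d\<in>{d. padd z (dvec d) \<in> D}. edge_strength str B z d)"
    unfolding ce by (subst sum.reindex) (auto simp: inj_on_def)
  finally have ge2: "2 \<le> (\<Sum>d\<in>{d. padd z (dvec d) \<in> D}. edge_strength str B z d)" .
  have edge: "edge_strength str B z d = (if t d = tile_at (padd z (dvec d)) (opp d) then str (t d) else 0)"
    if "padd z (dvec d) \<in> D" for d
    using that z by (simp add: edge_strength_def B restr_def)
  have zin: "z \<in> X \<and> d \<in> I z \<and> tile_at (padd z (dvec d)) (opp d) = tile_at z d"
    if d: "padd z (dvec d) \<in> D" and nz: "tile_at (padd z (dvec d)) (opp d) \<noteq> 0" for d
  proof -
    \<comment> \<open>Otherwise \<open>z\<close> would be an input of a cell of \<open>D\<close>,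
      and \<open>D\<close> would already contain it.\<close>
    have n: "opp d \<notin> I (padd z (dvec d))"
    proof
      assume "opp d \<in> I (padd z (dvec d))"
      then have "padd (padd z (dvec d)) (dvec (opp d)) \<in> D" using D d unfolding closed_def by blast
      then show False using z by simp
    qed
    then have "0 < out (padd z (dvec d)) (opp d)"
      using nz by (auto simp: tile_at_def split: if_splits)
    moreover have "padd (padd z (dvec d)) (dvec (opp d)) = z" by simp
    ultimately have "z \<in> X \<and> d \<in> I z"
      by (simp add: out_strength_def split: if_splits)
    then show ?thesis
      using n out_input[of z d] input_strength[of z] I_nonempty[of z d] by (auto simp: tile_at_def)
  qed
  define M where "M = {d \<in> I z. padd z (dvec d) \<in> D \<and> t d = tile_at z d}"
  have pos: "z \<in> X \<and> d \<in> M" if "padd z (dvec d) \<in> D" "edge_strength str B z d \<noteq> 0" for d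
  proof -
    have "t d = tile_at (padd z (dvec d)) (opp d)" "t d \<noteq> 0"
      using that edge[of d] str_0 by (metis, metis)
    then show ?thesis using zin[OF that(1)] that(1) by (auto simp: M_def)
  qed
  have zX: "z \<in> X"
  proof (rule ccontr)
    assume "z \<notin> X"
    then have "(\<Sum>d\<in>{d. padd z (dvec d) \<in> D}. edge_strength str B z d) = 0"
      using pos by (intro sum.neutral) auto
    then show False using ge2 by simp
  qed
  have zz0: "z \<noteq> z0" using z \<open>z0 \<in> D\<close> by auto
  have "(\<Sum>d\<in>{d. padd z (dvec d) \<in> D}. edge_strength str B z d) = (\<Sum>d\<in>M. edge_strength str B z d)"
    using pos by (intro sum.mono_neutral_right) (auto simp: M_def)
  also have "\<dots> \<le> (\<Sum>d\<in>M. int (2 div card (I z)))"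
  proof (rule sum_mono)
    fix d assume d: "d \<in> M"
    then have "str (t d) = int (2 div card (I z))"
      using str_enc[OF glue_in[OF zX]] by (auto simp: M_def tile_at_def)
    then show "edge_strength str B z d \<le> int (2 div card (I z))"
      using edge[of d] d by (auto simp: M_def)
  qed
  finally have "2 \<le> card M * (2 div card (I z))" using ge2 by (simp flip: of_nat_mult)
  moreover have "card M \<le> card (I z)" by (auto simp: M_def intro: card_mono)
  ultimately have "card M = card (I z)"
    using card_I[OF zX zz0] by auto
  then have M: "M = I z" by (intro card_subset_eq) (auto simp: M_def)
  obtain y where y: "y \<in> X" "t = tile_at y" using t by auto
  have "I z \<noteq> {}" using card_I[OF zX zz0] by auto
  then obtain d where d: "d \<in> I z" by auto
  \<comment> \<open>The seed tile has output glues only, and these point in the wrong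
    direction.\<close>
  have yz0: "y \<noteq> z0"
  proof
    assume "y = z0"
    then have "tile_at z0 d = tile_at z d" using d M y by (auto simp: M_def)
    then have e: "tile_at z0 d = enc (s (padd z (dvec d)), opp d, 2 div card (I z))"
      using d by (simp add: tile_at_def)
    then have "0 < out z0 d" using z0 by (auto simp: tile_at_def split: if_splits)
    then show False
      using e z0 enc_eq[OF glue_out[OF z0(1)] glue_in[OF zX d]] by (simp add: tile_at_def)
  qed
  have "t = tile_at z"
    using tile_at_eqI[OF zX y(1) zz0 yz0] M y by (auto simp: M_def)
  then have "B = restr (insert z D)" using B by (auto simp: restr_def fun_eq_iff)
  moreover have "closed (insert z D)" using D zX M by (auto simp: closed_def M_def)
  ultimately show ?thesis by blast
qed

text \<open>In a terminal production no cell of \<open>X\<close> is missing: a missing cell of least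
  rank would have all its inputs and could attach.\<close>

theorem strictly_assembles: "valid_tas sys \<and> temp sys = 2 \<and> strictly_self_assembles sys X"
proof (intro conjI)
  have seed: "seed sys = restr {z0}" by (auto simp: sys_def restr_def)
  have ran: "ran (restr {z0}) \<subseteq> tile_at ` X"
    using z0 by (auto simp: ran_def restr_def split: if_splits)
  have c0: "closed {z0}" using z0 by (auto simp: closed_def)
  show "temp sys = 2" by (simp add: sys_def)
  show "valid_tas sys"
    using finite_tiles stable_restr[OF c0] z0(1) ran unfolding valid_tas_def seed dom_restr
    by (auto simp: sys_def)
  show "strictly_self_assembles sys X"
    unfolding strictly_self_assembles_def
  proof (intro allI impI)
    fix A assume tp: "terminal_production sys A"
    then obtain f where f0: "f 0 = seed sys"
      and fS: "\<And>n. f (Suc n) = f n \<or> attaches sys (f n) (f (Suc n))"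
      and fA: "\<And>z. A z = None \<longleftrightarrow> (\<forall>n. f n z = None)" "\<And>z n. f n z \<noteq> None \<Longrightarrow> A z = f n z"
      unfolding terminal_production_def production_def by blast
    have inv: "\<exists>D. closed D \<and> f n = restr D" for n
    proof (induction n)
      case 0
      then show ?case using f0 seed c0 by auto
    next
      case (Suc n)
      then obtain D where "closed D" "f n = restr D" by auto
      then show ?case using fS[of n] attach_step by metis
    qed
    have "\<forall>n. \<exists>D. closed D \<and> f n = restr D" using inv by blast
    then obtain Dn where Dn: "\<And>n. closed (Dn n)" "\<And>n. f n = restr (Dn n)" by metis
    define D where "D = (\<Union>n. Dn n)"
    have A: "A = restr D"
    proof
      fix z
      show "A z = restr D z"
      proof (cases "z \<in> D")
        case True
        then obtain n where "z \<in> Dn n" by (auto simp: D_def)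
        then have "f n z = Some (tile_at z)" by (simp add: Dn(2) restr_def)
        then show ?thesis using fA(2)[of n z] True by (simp add: restr_def)
      next
        case False
        then show ?thesis using fA(1)[of z] by (auto simp: D_def Dn(2) restr_def)
      qed
    qed
    have cD: "closed D" using Dn(1) by (fastforce simp: closed_def D_def)
    show "dom A = X"
    proof (rule ccontr)
      assume "dom A \<noteq> X"
      then have "X - D \<noteq> {}" using A cD by (auto simp: closed_def)
      then obtain z where z: "z \<in> X - D" and zmin: "\<And>y. y \<in> X - D \<Longrightarrow> rank z \<le> rank y"
        using ex_has_least_nat[of "\<lambda>z. z \<in> X - D" _ rank] by blast
      have "padd z (dvec d) \<in> D" if "d \<in> I z" for d
        using rank[of z d] zmin[of "padd z (dvec d)"] z that I_closed[of z d] by fastforce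
      then have "closed (insert z D)" using cD z by (auto simp: closed_def)
      then have "stable str 2 (restr (insert z D))" by (rule stable_restr)
      moreover have "restr (insert z D) = A(z \<mapsto> tile_at z)"
        by (auto simp: A restr_def fun_eq_iff)
      ultimately have "attaches sys A (A(z \<mapsto> tile_at z))"
        unfolding attaches_def using z
        by (intro exI[of _ z] exI[of _ "tile_at z"]) (simp add: A sys_def)
      then show False using tp by (auto simp: terminal_production_def)
    qed
  qed
qed

end

section \<open>Base-6 digits and the carpet\<close>

lemma mod6_cases:
  fixes x :: nat
  obtains "x mod 6 = 0" | "x mod 6 = 1" | "x mod 6 = 2" | "x mod 6 = 3" | "x mod 6 = 4" | "x mod 6 = 5"
  by linarith

lemma mod6_Suc: "Suc x mod 6 = (if x mod 6 = 5 then 0 else Suc (x mod 6))"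
  by (simp add: mod_Suc)

lemma div6_Suc: "Suc x div 6 = (if x mod 6 = 5 then Suc (x div 6) else x div 6)"
  by (simp add: div_Suc mod_Suc)

lemma mod6_pred: "(x - Suc 0) mod 6 = (if x mod 6 = 0 then (if x = 0 then 0 else 5) else x mod 6 - 1)"
  for x :: nat
  by (cases x) (auto simp: mod6_Suc)

lemma div6_pred: "(x - Suc 0) div 6 = (if x mod 6 = 0 then x div 6 - 1 else x div 6)"
  for x :: nat
  by (cases x) (auto simp: mod6_Suc div6_Suc)

lemma mod6_5_nz: "y mod 6 = 5 \<Longrightarrow> x \<noteq> 0 \<or> y \<noteq> 0" for x y :: nat
  by (cases "y = 0") auto

text \<open>Induction from a cell to its block. The guard is there because division fixes
  (0,0).\<close>

lemma digit_induct [case_names digit]: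
  fixes x y :: nat
  assumes "\<And>x y. (x \<noteq> 0 \<or> y \<noteq> 0 \<Longrightarrow> P (x div 6) (y div 6)) \<Longrightarrow> P x y"
  shows "P x y"
proof (induction "x + y" arbitrary: x y rule: less_induct)
  case less
  show ?case
  proof (rule assms)
    assume "x \<noteq> 0 \<or> y \<noteq> 0"
    then have "x div 6 + y div 6 < x + y" by linarith
    then show "P (x div 6) (y div 6)" by (rule less)
  qed
qed

function carpet :: "nat \<Rightarrow> nat \<Rightarrow> bool" where
  "carpet x y = (if x = 0 \<and> y = 0 then True
     else \<not> (x mod 6 \<in> {2, 3} \<and> y mod 6 \<in> {2, 3}) \<and> carpet (x div 6) (y div 6))"
  by auto
termination by (relation "measure (\<lambda>(x, y). x + y)") auto

declare carpet.simps [simp del]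

lemma carpet_0 [simp]: "carpet 0 0"
  by (simp add: carpet.simps)

lemma carpet_rec: "carpet x y \<longleftrightarrow> \<not> (x mod 6 \<in> {2, 3} \<and> y mod 6 \<in> {2, 3}) \<and> carpet (x div 6) (y div 6)"
  by (subst carpet.simps) auto

lemma carpet_sym: "carpet x y = carpet y x"
proof (induction x y rule: digit_induct)
  case (digit x y)
  then show ?case using carpet_rec[of x y] carpet_rec[of y x] by (cases "x = 0 \<and> y = 0") auto
qed

lemma carpet_div: "carpet x y \<Longrightarrow> carpet (x div 6) (y div 6)"
  using carpet_rec by blast

lemma carpet_hole: "carpet x y \<Longrightarrow> \<not> (x mod 6 \<in> {2, 3} \<and> y mod 6 \<in> {2, 3})"
  using carpet_rec by blast

lemma carpet_E: "carpet x y \<Longrightarrow> x mod 6 \<noteq> 5 \<Longrightarrow>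
    carpet (Suc x) y \<longleftrightarrow> \<not> (x mod 6 \<in> {1, 2} \<and> y mod 6 \<in> {2, 3})"
  using carpet_rec[of x y] carpet_rec[of "Suc x" y] by (auto simp: mod6_Suc div6_Suc)

lemma carpet_E5: "carpet x y \<Longrightarrow> x mod 6 = 5 \<Longrightarrow> carpet (Suc x) y \<longleftrightarrow> carpet (Suc (x div 6)) (y div 6)"
  using carpet_rec[of x y] carpet_rec[of "Suc x" y] by (auto simp: mod6_Suc div6_Suc)

lemma carpet_N: "carpet x y \<Longrightarrow> y mod 6 \<noteq> 5 \<Longrightarrow>
    carpet x (Suc y) \<longleftrightarrow> \<not> (y mod 6 \<in> {1, 2} \<and> x mod 6 \<in> {2, 3})"
  using carpet_E[of y x] by (simp add: carpet_sym)

lemma carpet_N5: "carpet x y \<Longrightarrow> y mod 6 = 5 \<Longrightarrow> carpet x (Suc y) \<longleftrightarrow> carpet (x div 6) (Suc (y div 6))"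
  using carpet_E5[of y x] by (simp add: carpet_sym)

section \<open>Cells without a western or southern neighbour\<close>

definition west_free :: "nat \<Rightarrow> nat \<Rightarrow> bool" where
  "west_free x y \<longleftrightarrow> x = 0 \<or> \<not> carpet (x - 1) y"

definition south_free :: "nat \<Rightarrow> nat \<Rightarrow> bool" where
  "south_free x y \<longleftrightarrow> west_free y x"

lemma south_free_iff: "south_free x y \<longleftrightarrow> y = 0 \<or> \<not> carpet x (y - 1)"
  using carpet_sym by (simp add: south_free_def west_free_def)

text \<open>Inside a block only the cells just east of its hole lose their western neighbour; in
  column 0 the question passes to the block.\<close>

lemma west_free_rec: "carpet x y \<Longrightarrow> west_free x y \<longleftrightarrow>
    (if x mod 6 = 0 then west_free (x div 6) (y div 6) else x mod 6 = 4 \<and> y mod 6 \<in> {2, 3})"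
proof -
  assume X: "carpet x y"
  show ?thesis
  proof (cases "x = 0")
    case False
    have "x mod 6 = 0 \<Longrightarrow> x div 6 \<noteq> 0" using False by presburger
    then show ?thesis
      using False X carpet_div[OF X] carpet_hole[OF X] carpet_rec[of "x - 1" y]
      by (cases x rule: mod6_cases) (simp_all add: west_free_def mod6_pred div6_pred)
  qed (simp add: west_free_def)
qed

lemma south_free_rec: "carpet x y \<Longrightarrow> south_free x y \<longleftrightarrow>
    (if y mod 6 = 0 then south_free (x div 6) (y div 6) else y mod 6 = 4 \<and> x mod 6 \<in> {2, 3})"
  using west_free_rec[of y x] by (simp add: south_free_def carpet_sym)

lemma west_free_Suc [simp]: "carpet x y \<Longrightarrow> \<not> west_free (Suc x) y"
  by (simp add: west_free_def)

lemma south_free_Suc [simp]: "carpet x y \<Longrightarrow> \<not> south_free x (Suc y)"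
  by (simp add: south_free_iff)

lemma west_free_mod: "carpet x y \<Longrightarrow> west_free x y \<Longrightarrow> x mod 6 = 0 \<or> x mod 6 = 4 \<and> y mod 6 \<in> {2, 3}"
  using west_free_rec[of x y] by (auto split: if_splits)

lemma south_free_mod: "carpet x y \<Longrightarrow> south_free x y \<Longrightarrow> y mod 6 = 0 \<or> y mod 6 = 4 \<and> x mod 6 \<in> {2, 3}"
  using south_free_rec[of x y] by (auto split: if_splits)

text \<open>The cells just east and just north of a hole differ, so both digits are 0 on every
  level. Hence the origin alone is without inputs.\<close>

lemma west_free_south_free: "carpet x y \<Longrightarrow> west_free x y \<Longrightarrow> south_free x y \<Longrightarrow> x = 0 \<and> y = 0"
proof (induction x y rule: digit_induct)
  case (digit x y)
  have "x mod 6 = 0" "y mod 6 = 0" "west_free (x div 6) (y div 6)" "south_free (x div 6) (y div 6)"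
    using west_free_rec[OF digit.prems(1)] south_free_rec[OF digit.prems(1)] digit.prems(2,3) by (auto split: if_splits)
  moreover have "x \<noteq> 0 \<or> y \<noteq> 0 \<Longrightarrow> x div 6 = 0 \<and> y div 6 = 0"
    using digit.IH[OF _ carpet_div[OF digit.prems(1)]] calculation by blast
  ultimately show ?case by presburger
qed

text \<open>The first digit is 0 or 4, and these columns of a block miss its hole. At the top of the
  block, the block is itself without a western neighbour.\<close>

lemma west_free_N: "carpet x y \<Longrightarrow> west_free x y \<Longrightarrow> carpet x (Suc y)"
proof (induction x y rule: digit_induct)
  case (digit x y)
  note X = carpet_div[OF digit.prems(1)]
  show ?case
  proof (cases "y mod 6 = 5")
    case y5: True
    then have "west_free (x div 6) (y div 6)"
      using west_free_rec[OF digit.prems(1)] digit.prems(2) by (auto split: if_splits)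
    then show ?thesis
      using digit.IH[OF mod6_5_nz[OF y5] X] carpet_N5[OF digit.prems(1) y5] by simp
  next
    case False
    then show ?thesis using carpet_N[OF digit.prems(1)] west_free_mod[OF digit.prems] by auto
  qed
qed

section \<open>Reversed rows and columns\<close>

definition south_fed :: "nat \<Rightarrow> nat \<Rightarrow> bool" where
  "south_fed x y \<longleftrightarrow> west_free x y \<and> \<not> south_free x y"

text \<open>A cell is in a reversed row if it lies in the topmost row of some block whose only neighbour
  among the western and southern one is the southern one; \<open>row_start\<close> marks the eastern end of such a
  row, and \<open>rev_block\<close> is the largest block whose topmost row it is.  Columns are obtained by
  transposition.\<close>

function rev_row :: "nat \<Rightarrow> nat \<Rightarrow> bool" where
  "rev_row x y = (if y mod 6 = 5 then south_fed (x div 6) (y div 6) \<or> rev_row (x div 6) (y div 6) else False)"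
  by auto
termination
  by (relation "measure (\<lambda>(x, y). y)") (auto intro!: div_less_dividend gr0I)

function row_start :: "nat \<Rightarrow> nat \<Rightarrow> bool" where
  "row_start x y = (if x mod 6 = 5 \<and> y mod 6 = 5
     then south_fed (x div 6) (y div 6) \<and> \<not> rev_row (x div 6) (y div 6) \<or> row_start (x div 6) (y div 6) else False)"
  by auto
termination
  by (relation "measure (\<lambda>(x, y). y)") (auto intro!: div_less_dividend gr0I)

function rev_block :: "nat \<Rightarrow> nat \<Rightarrow> nat \<times> nat" where
  "rev_block x y = (if y mod 6 = 5 \<and> (\<not> south_fed (x div 6) (y div 6) \<or> rev_row (x div 6) (y div 6))
     then rev_block (x div 6) (y div 6) else (x div 6, y div 6))"
  by auto
termination
  by (relation "measure (\<lambda>(x, y). y)") (auto intro!: div_less_dividend gr0I)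

declare rev_row.simps [simp del] row_start.simps [simp del] rev_block.simps [simp del]

definition rev_col :: "nat \<Rightarrow> nat \<Rightarrow> bool" where
  "rev_col x y = rev_row y x"

definition col_start :: "nat \<Rightarrow> nat \<Rightarrow> bool" where
  "col_start x y = row_start y x"

lemma rev_row_mod: "rev_row x y \<Longrightarrow> y mod 6 = 5"
  by (subst (asm) rev_row.simps) (auto split: if_splits)

lemma row_start_mod: "row_start x y \<Longrightarrow> x mod 6 = 5 \<and> y mod 6 = 5"
  by (subst (asm) row_start.simps) (auto split: if_splits)

lemma rev_row_rec: "y mod 6 = 5 \<Longrightarrow> rev_row x y \<longleftrightarrow> south_fed (x div 6) (y div 6) \<or> rev_row (x div 6) (y div 6)"
  by (subst rev_row.simps) simp

lemma row_start_rec: "x mod 6 = 5 \<Longrightarrow> y mod 6 = 5 \<Longrightarrow>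
    row_start x y \<longleftrightarrow> south_fed (x div 6) (y div 6) \<and> \<not> rev_row (x div 6) (y div 6) \<or> row_start (x div 6) (y div 6)"
  by (subst row_start.simps) simp

lemma row_start_rev_row: "row_start x y \<Longrightarrow> rev_row x y"
proof (induction x y rule: digit_induct)
  case (digit x y)
  have m: "x mod 6 = 5" "y mod 6 = 5" using row_start_mod[OF digit.prems] by auto
  show ?case
    using digit.IH[OF mod6_5_nz[OF m(2)]] digit.prems row_start_rec[OF m] rev_row_rec[OF m(2), of x] by blast
qed

text \<open>No reversal can begin on the western side of a block with a western neighbour, since
  such a block is not \<open>south_fed\<close>.\<close>

lemma rev_row_E: "carpet x y \<Longrightarrow> carpet (Suc x) y \<Longrightarrow> rev_row (Suc x) y \<longleftrightarrow> rev_row x y \<and> \<not> row_start x y"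
proof (induction x y rule: digit_induct)
  case (digit x y)
  let ?x = "x div 6" and ?y = "y div 6"
  note X = carpet_div[OF digit.prems(1)]
  show ?case
  proof (cases "y mod 6 = 5")
    case y5: True
    show ?thesis
    proof (cases "x mod 6 = 5")
      case x5: True
      have "carpet (Suc ?x) ?y" using carpet_E5[OF digit.prems(1) x5] digit.prems(2) by simp
      then have "rev_row (Suc ?x) ?y \<longleftrightarrow> rev_row ?x ?y \<and> \<not> row_start ?x ?y"
        using digit.IH[OF mod6_5_nz[OF y5] X] by simp
      then show ?thesis
        using rev_row_rec[OF y5, of x] rev_row_rec[OF y5, of "Suc x"] row_start_rec[OF x5 y5] row_start_rev_row[of ?x ?y] x5 X
        by (auto simp: south_fed_def div6_Suc)
    next
      case False
      then show ?thesis
        using rev_row_rec[OF y5, of x] rev_row_rec[OF y5, of "Suc x"] row_start_mod[of x y] by (auto simp: div6_Suc)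
    qed
  next
    case False
    then show ?thesis using rev_row_mod by blast
  qed
qed

lemma rev_col_N: "carpet x y \<Longrightarrow> carpet x (Suc y) \<Longrightarrow> rev_col x (Suc y) \<longleftrightarrow> rev_col x y \<and> \<not> col_start x y"
  using rev_row_E[of y x] by (simp add: rev_col_def col_start_def carpet_sym)

text \<open>A block that is \<open>south_fed\<close> has first digit 0 or 4, whereas a reversed
  column has first digit 5; so a conflict would have to persist through all levels.\<close>

lemma rev_row_not_rev_col: "carpet x y \<Longrightarrow> rev_row x y \<Longrightarrow> \<not> rev_col x y"
proof (induction x y rule: digit_induct)
  case (digit x y)
  let ?x = "x div 6" and ?y = "y div 6"
  note X = carpet_div[OF digit.prems(1)]
  have y5: "y mod 6 = 5" using digit.prems(2) by (rule rev_row_mod)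
  show ?case
  proof
    assume "rev_col x y"
    then have r: "rev_row y x" and x5: "x mod 6 = 5" by (auto simp: rev_col_def dest: rev_row_mod)
    have "south_fed ?x ?y \<or> rev_row ?x ?y" "south_fed ?y ?x \<or> rev_row ?y ?x"
      using digit.prems(2) r rev_row_rec[OF y5, of x] rev_row_rec[OF x5, of y] by auto
    then show False
      using digit.IH[OF mod6_5_nz[OF y5] X] west_free_mod[OF X] south_free_mod[OF X] rev_row_mod[of ?x ?y] rev_row_mod[of ?y ?x]
      by (auto simp: south_fed_def rev_col_def south_free_def)
  qed
qed

text \<open>Row 5 of a block meets no hole. At its eastern end the block lies in a reversed row
  without being the start, and the argument repeats.\<close>

lemma rev_row_not_start_E: "carpet x y \<Longrightarrow> rev_row x y \<Longrightarrow> \<not> row_start x y \<Longrightarrow> carpet (Suc x) y"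
proof (induction x y rule: digit_induct)
  case (digit x y)
  let ?x = "x div 6" and ?y = "y div 6"
  note X = carpet_div[OF digit.prems(1)]
  have y5: "y mod 6 = 5" using digit.prems(2) by (rule rev_row_mod)
  show ?case
  proof (cases "x mod 6 = 5")
    case x5: True
    then have "rev_row ?x ?y" "\<not> row_start ?x ?y"
      using digit.prems(2,3) rev_row_rec[OF y5, of x] row_start_rec[OF x5 y5] by auto
    then show ?thesis
      using digit.IH[OF mod6_5_nz[OF y5] X] carpet_E5[OF digit.prems(1) x5] by simp
  next
    case False
    then show ?thesis using carpet_E[OF digit.prems(1)] y5 by simp
  qed
qed

lemma rev_row_N: "carpet x y \<Longrightarrow> rev_row x y \<Longrightarrow> carpet x (Suc y)"
proof (induction x y rule: digit_induct)
  case (digit x y)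
  note X = carpet_div[OF digit.prems(1)]
  have y5: "y mod 6 = 5" using digit.prems(2) by (rule rev_row_mod)
  then have "south_fed (x div 6) (y div 6) \<or> rev_row (x div 6) (y div 6)"
    using digit.prems(2) rev_row_rec by blast
  then show ?case
    using digit.IH[OF mod6_5_nz[OF y5] X] west_free_N[OF X] carpet_N5[OF digit.prems(1) y5]
    by (auto simp: south_fed_def)
qed

text \<open>Because of this, a cell of a reversed row can simply copy the description of the block
  from its eastern neighbour.\<close>

lemma rev_block_E: "carpet x y \<Longrightarrow> rev_row x y \<Longrightarrow> \<not> row_start x y \<Longrightarrow> rev_block (Suc x) y = rev_block x y"
proof (induction x y rule: digit_induct)
  case (digit x y)
  let ?x = "x div 6" and ?y = "y div 6"
  note X = carpet_div[OF digit.prems(1)]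
  have y5: "y mod 6 = 5" using digit.prems(2) by (rule rev_row_mod)
  show ?case
  proof (cases "x mod 6 = 5")
    case x5: True
    then have r: "rev_row ?x ?y" "\<not> row_start ?x ?y"
      using digit.prems(2,3) rev_row_rec[OF y5, of x] row_start_rec[OF x5 y5] by auto
    have "rev_block (Suc ?x) ?y = rev_block ?x ?y"
      using digit.IH[OF mod6_5_nz[OF y5] X] r by simp
    then show ?thesis
      using r x5 y5 X by (simp add: rev_block.simps[of x y] rev_block.simps[of "Suc x" y] div6_Suc south_fed_def)
  next
    case False
    then have "Suc x div 6 = x div 6" by (simp add: div6_Suc)
    then show ?thesis unfolding rev_block.simps[of x y] rev_block.simps[of "Suc x" y] by auto
  qed
qed

text \<open>The northern and eastern neighbours of a north-east corner of nested blocks are decided by the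
  address of the first block that is not itself a north-east corner.\<close>

function corner_block :: "nat \<Rightarrow> nat \<Rightarrow> nat \<times> nat" where
  "corner_block x y = (if x mod 6 = 5 \<and> y mod 6 = 5 then corner_block (x div 6) (y div 6) else (x, y))"
  by auto
termination
  by (relation "measure (\<lambda>(x, y). y)") (auto intro!: div_less_dividend gr0I)

declare corner_block.simps [simp del]

lemma corner_block_sym: "corner_block y x = prod.swap (corner_block x y)"
proof (induction x y rule: digit_induct)
  case (digit x y)
  then show ?case using corner_block.simps[of x y] corner_block.simps[of y x] by (cases "x = 0 \<and> y = 0") auto
qed

text \<open>Hence the corner wires deliver to the first cell of a reversed row precisely the
  description that the row has to carry.\<close>

lemma row_start_rev_block: "carpet x y \<Longrightarrow> row_start x y \<Longrightarrow> rev_block x y = corner_block (x div 6) (y div 6)"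
proof (induction x y rule: digit_induct)
  case (digit x y)
  let ?x = "x div 6" and ?y = "y div 6"
  note X = carpet_div[OF digit.prems(1)]
  have m: "x mod 6 = 5" "y mod 6 = 5" using row_start_mod[OF digit.prems(2)] by auto
  from digit.prems(2) consider "south_fed ?x ?y" "\<not> rev_row ?x ?y" | "row_start ?x ?y"
    using row_start_rec[OF m] by auto
  then show ?case
  proof cases
    case 1
    then have "?x mod 6 \<noteq> 5" using west_free_mod[OF X] by (auto simp: south_fed_def)
    then show ?thesis using 1 by (simp add: rev_block.simps[of x y] corner_block.simps[of ?x ?y])
  next
    case 2
    then show ?thesis
      using digit.IH[OF mod6_5_nz[OF m(2)] X] row_start_rev_row[of ?x ?y] row_start_mod[of ?x ?y] m
      by (simp add: rev_block.simps[of x y] corner_block.simps[of ?x ?y])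
  qed
qed

text \<open>A cell is born after its inputs: \<open>weight x + weight y\<close> serves away from reversed lines, and
  \<open>2 * lag x y\<close> is the delay along a reversed row, which is less than the gap to the next row.\<close>

function weight :: "nat \<Rightarrow> nat" where
  "weight x = (if x = 0 then 0 else x mod 6 + 36 * weight (x div 6))"
  by auto
termination by (relation "measure (\<lambda>x. x)") auto

declare weight.simps [simp del]

lemma weight_rec: "weight x = x mod 6 + 36 * weight (x div 6)"
  by (cases "x = 0") (simp_all add: weight.simps[of x] weight.simps[of 0])

lemma weight_less: "weight x < weight (Suc x)"
proof (induction x rule: less_induct)
  case (less x)
  show ?case
  proof (cases "x mod 6 = 5")
    case True
    then have "x div 6 < x" by (cases "x = 0") auto
    from less[OF this] show ?thesis
      using True weight_rec[of x] weight_rec[of "Suc x"] by (simp add: mod6_Suc div6_Suc)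
  next
    case False
    then show ?thesis using weight_rec[of x] weight_rec[of "Suc x"] by (simp add: mod6_Suc div6_Suc)
  qed
qed

function lag :: "nat \<Rightarrow> nat \<Rightarrow> nat" where
  "lag x y = (if y mod 6 = 5 then (5 - x mod 6) +
     (if rev_row (x div 6) (y div 6) then 36 * lag (x div 6) (y div 6) else 0) else 0)"
  by auto
termination
  by (relation "measure (\<lambda>(x, y). y)") (auto intro!: div_less_dividend gr0I)

declare lag.simps [simp del]

text \<open>One level contributes at most 2 * 5 + 5 = 15 to the left side, while the gap between
  block rows, at least 1, is multiplied by 36.\<close>

lemma lag_less: "rev_row x y \<Longrightarrow> 2 * lag x y + weight y < weight (Suc y)"
proof (induction x y rule: digit_induct)
  case (digit x y)
  let ?x = "x div 6" and ?y = "y div 6"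
  have y5: "y mod 6 = 5" using digit.prems by (rule rev_row_mod)
  define l where "l = (if rev_row ?x ?y then lag ?x ?y else 0)"
  have "2 * l + weight ?y < weight (Suc ?y)"
    using digit.IH[OF mod6_5_nz[OF y5]] weight_less[of ?y] by (simp add: l_def)
  moreover have "lag x y \<le> 5 + 36 * l" using y5 lag.simps[of x y] by (simp add: l_def)
  moreover have "weight y = 5 + 36 * weight ?y" "weight (Suc y) = 36 * weight (Suc ?y)"
    using y5 weight_rec[of y] weight_rec[of "Suc y"] by (simp_all add: mod6_Suc div6_Suc)
  ultimately show ?case by linarith
qed

text \<open>Eastwards \<open>lag\<close> drops by what \<open>weight\<close> gains. Counted twice,
  it makes the eastern neighbour earlier, which is why \<open>birth\<close> doubles it.\<close>

lemma lag_E: "carpet x y \<Longrightarrow> rev_row x y \<Longrightarrow> \<not> row_start x y \<Longrightarrow> lag x y + weight x = lag (Suc x) y + weight (Suc x)"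
proof (induction x y rule: digit_induct)
  case (digit x y)
  let ?x = "x div 6" and ?y = "y div 6"
  note X = carpet_div[OF digit.prems(1)]
  have y5: "y mod 6 = 5" using digit.prems(2) by (rule rev_row_mod)
  show ?case
  proof (cases "x mod 6 = 5")
    case True
    then have r: "rev_row ?x ?y" "\<not> row_start ?x ?y"
      using digit.prems y5 rev_row.simps[of x y] row_start.simps[of x y] by auto
    have "lag ?x ?y + weight ?x = lag (Suc ?x) ?y + weight (Suc ?x)"
      by (rule digit.IH[OF mod6_5_nz[OF y5] X r])
    moreover have "rev_row (Suc ?x) ?y" using rev_row_E[OF X rev_row_not_start_E[OF X r]] r by simp
    ultimately show ?thesis
      using True y5 r weight_rec[of x] weight_rec[of "Suc x"] lag.simps[of x y] lag.simps[of "Suc x" y]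
      by (simp add: mod6_Suc div6_Suc)
  next
    case False
    then have "x mod 6 < 5" using mod_less_divisor[of 6 x] by linarith
    then show ?thesis
      using y5 weight_rec[of x] weight_rec[of "Suc x"] lag.simps[of x y] lag.simps[of "Suc x" y]
      by (auto simp: mod6_Suc div6_Suc)
  qed
qed

lemma row_start_lag: "row_start x y \<Longrightarrow> lag x y = 0"
proof (induction x y rule: digit_induct)
  case (digit x y)
  have m: "x mod 6 = 5" "y mod 6 = 5" using row_start_mod[OF digit.prems] by auto
  show ?case
    using digit.IH[OF mod6_5_nz[OF m(2)]] digit.prems row_start_rec[OF m] lag.simps[of x y] m
    by auto
qed

section \<open>Wires\<close>

text \<open>\<open>Own\<close> describes a block: its address in the parent block, whether it lacks a western and a southern
  neighbour, whether the parent is the block of the origin, and its effective address.  \<open>Turn\<close> asks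
  column 0 to pick up the content of row 4.\<close>

datatype content = Nul | Own "nat \<times> nat" bool bool bool "nat \<times> nat" | Turn | Ax "nat \<times> nat"

fun cpos :: "content \<Rightarrow> nat \<times> nat" where
  "cpos (Own r w s b e) = r" | "cpos _ = (0, 0)"

fun ceff :: "content \<Rightarrow> nat \<times> nat" where
  "ceff (Own r w s b e) = e" | "ceff (Ax e) = e" | "ceff _ = (0, 0)"

fun set_effective :: "nat \<times> nat \<Rightarrow> content \<Rightarrow> content" where
  "set_effective e (Own r w s b e') = Own r w s b e" | "set_effective e c = c"

abbreviation digits :: "nat \<Rightarrow> nat \<Rightarrow> nat \<times> nat" where
  "digits x y \<equiv> (x mod 6, y mod 6)"

text \<open>A block at address (4,4) contains the crossing of wires that already cross in the parent block,
  and has to treat them as the parent block does.\<close>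

function effective :: "nat \<Rightarrow> nat \<Rightarrow> nat \<times> nat" where
  "effective x y = (if x mod 6 = 4 \<and> y mod 6 = 4 then effective (x div 6) (y div 6) else digits x y)"
  by auto
termination
  by (relation "measure (\<lambda>(x, y). y)") (auto intro!: div_less_dividend gr0I)

declare effective.simps [simp del]

text \<open>Of the blocks without a western neighbour, only that of the origin has no southern one,
  hence no reversed topmost row. Its cells have to know this exception.\<close>

definition origin_block :: "nat \<Rightarrow> nat \<Rightarrow> bool" where
  "origin_block x y \<longleftrightarrow> x div 6 = 0 \<and> y div 6 = 0"

definition own :: "nat \<Rightarrow> nat \<Rightarrow> content" where
  "own x y = Own (digits x y) (west_free x y) (south_free x y) (origin_block x y) (effective x y)"

definition corner_own :: "nat \<Rightarrow> nat \<Rightarrow> content" where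
  "corner_own x y = case_prod own (corner_block x y)"

text \<open>This is the second content, besides the wire of column 4, that goes north in the cells below (4,4):
  it brings the effective address of the block to the crossing.\<close>

definition aux :: "nat \<Rightarrow> nat \<Rightarrow> content" where
  "aux x y = (if x mod 6 = 4 \<and> y mod 6 \<in> {1, 2, 3} then Ax (effective (x div 6) (y div 6)) else Nul)"

text \<open>\<open>wire_E\<close> and \<open>wire_N\<close> are the contents leaving a cell, or a block of any level, to the east and
  to the north, as long as these sides are outputs.\<close>

function wire_E :: "nat \<Rightarrow> nat \<Rightarrow> content" where
  "wire_E x y = (let X = x div 6; Y = y div 6; i = x mod 6; j = y mod 6 in
     if j = 1 then
       (if i = 0 then (if west_free X Y then Nul
          else if digits X Y = (4, 4) then set_effective (effective X Y) (own (X - 1) Y) else own (X - 1) Y)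
        else own X Y)
     else if j = 4 then (if i \<le> 3 then (if west_free X Y then Nul else wire_E (X - 1) Y) else wire_E X Y)
     else if j = 5 then (if i = 0 then Nul else if i \<le> 3 then own X Y else corner_own X Y)
     else Nul)"
  by auto
termination
  by (relation "measure (\<lambda>(x, y). y)") (auto intro!: div_less_dividend gr0I)

text \<open>Column 0 has no counterpart in \<open>wire_E\<close>: it carries \<open>aux\<close> on
  the level of blocks. In block (4,1) it copies the effective address of the parent off row 4, where
  the parent's description passes; it climbs through blocks (4,2) and (4,3) and is absorbed by cell
  (0,1) of block (4,4).\<close>

function wire_N :: "nat \<Rightarrow> nat \<Rightarrow> content" where
  "wire_N x y = (let X = x div 6; Y = y div 6; i = x mod 6; j = y mod 6 in
     if i = 0 then
       (if j = 0 then (if south_free X Y then Nul else aux X (Y - 1))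
        else if j \<le> 3 then (if digits X Y = (4, 1) then Turn else aux X Y)
        else aux X Y)
     else if i = 1 then (if j = 0 then (if south_free X Y then Nul else own X (Y - 1)) else own X Y)
     else if i = 4 then (if j \<le> 3 then (if south_free X Y then Nul else wire_N X (Y - 1)) else wire_N X Y)
     else if i = 5 then (if j = 0 then Nul else if j \<le> 3 then own X Y else corner_own X Y)
     else Nul)"
  by auto
termination
  by (relation "measure (\<lambda>(x, y). x)") (auto intro!: div_less_dividend gr0I)

declare wire_E.simps [simp del] wire_N.simps [simp del]

definition inc :: "nat \<Rightarrow> nat" where
  "inc i = (if i = 5 then 0 else Suc i)"

text \<open>The local rules: \<open>gate_E r w s\<close> and \<open>gate_N r w s\<close> are sent by a cell with address \<open>r\<close>
  that receives \<open>w\<close> from the west and \<open>s\<close> from the south.\<close>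

fun merge_own :: "content \<Rightarrow> content \<Rightarrow> content" where
  "merge_own (Own (i, j) w s b e) c = Own (inc i, j) False (c = Nul) (b \<and> i \<noteq> 5)
      (if (inc i, j) = (4, 4) then e else (inc i, j))"
| "merge_own c (Own (i, j) w s b e) = Own (i, inc j) (c = Nul) False (b \<and> j \<noteq> 5) (i, inc j)"
| "merge_own c c' = Own (0, 0) True True True (0, 0)"

definition gate_E :: "nat \<times> nat \<Rightarrow> content \<Rightarrow> content \<Rightarrow> content" where
  "gate_E r w s = (case r of (i, j) \<Rightarrow>
     if j = 1 then (if i = 0 then (if cpos w = (3, 4) then set_effective (ceff s) w else w)
                    else if i = 1 then merge_own w s else w)
     else if j = 4 then w
     else if j = 5 then (if i = 0 then Nul else if i = 1 then s else if i \<le> 3 then w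
                         else if i = 4 then (if cpos w = (5, 5) then s else w)
                         else if s = Nul then w else s)
     else Nul)"

definition gate_N :: "nat \<times> nat \<Rightarrow> content \<Rightarrow> content \<Rightarrow> content" where
  "gate_N r w s = (case r of (i, j) \<Rightarrow>
     if i = 0 then (if j = 1 then (if w = Nul then s else if cpos w = (3, 1) then Turn else Nul)
                    else if j = 4 then (if s = Turn then Ax (ceff w) else s) else s)
     else if i = 1 then (if j = 1 then merge_own w s else s)
     else if i = 4 then s
     else if i = 5 then (if j = 0 then Nul else if j = 1 then w else if j \<le> 3 then s
                         else if j = 4 then (if cpos s = (5, 5) then w else s)
                         else if s = Nul then w else s)
     else Nul)"

definition from_W :: "nat \<Rightarrow> nat \<Rightarrow> content" where
  "from_W x y = (if west_free x y then Nul else wire_E (x - 1) y)"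

definition from_S :: "nat \<Rightarrow> nat \<Rightarrow> content" where
  "from_S x y = (if south_free x y then Nul else wire_N x (y - 1))"

lemma own_neq_Nul [simp]: "own x y \<noteq> Nul" "own x y \<noteq> Turn" "corner_own x y \<noteq> Nul" "set_effective e (own x y) \<noteq> Nul"
  by (simp_all add: own_def corner_own_def split: prod.split)

lemma cpos_own [simp]: "cpos (own x y) = digits x y" "ceff (own x y) = effective x y"
  "cpos (set_effective e (own x y)) = digits x y"
  by (simp_all add: own_def)

lemma aux_neq [simp]: "aux x y \<noteq> Turn"
  by (simp add: aux_def)

lemma pos_pred_mod: "\<not> west_free x y \<Longrightarrow> (x - Suc 0) mod 6 = (if x mod 6 = 0 then 5 else x mod 6 - 1) \<and> 0 < x"
  by (auto simp: mod6_pred west_free_def)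

lemma corner_own_rec: "corner_own x y = (if digits x y = (5, 5) then corner_own (x div 6) (y div 6) else own x y)"
  unfolding corner_own_def by (subst corner_block.simps) auto

lemma effective_rec: "effective x y = (if digits x y = (4, 4) then effective (x div 6) (y div 6) else digits x y)"
  by (subst effective.simps) auto

text \<open>In cell (1,1) of a block the descriptions of the western and southern blocks meet and
  yield its own. If neither arrives, this is the block of the origin, whence the default in
  \<open>merge_own\<close>. Address (4,4) always has a western neighbour, so its effective address
  can ride on the western description.\<close>

lemma merge_own_eq:
  assumes X: "carpet x y"
  shows "merge_own (if west_free x y then Nul else if digits x y = (4, 4) then set_effective (effective x y) (own (x - 1) y) else own (x - 1) y)
            (if south_free x y then Nul else own x (y - 1)) = own x y"
proof (cases "west_free x y")
  case False
  have "inc ((x - Suc 0) mod 6) = x mod 6" and "0 < x"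
    using pos_pred_mod[OF False] mod_less_divisor[of 6 x] by (auto simp: inc_def)
  moreover have "origin_block x y \<longleftrightarrow> origin_block (x - Suc 0) y \<and> (x - Suc 0) mod 6 \<noteq> 5"
    using pos_pred_mod[OF False] by (auto simp: origin_block_def div6_pred split: if_splits)
  ultimately show ?thesis
    using False by (auto simp: own_def effective_rec[of x y])
next
  case west_free: True
  then have nd: "digits x y \<noteq> (4, 4)" using west_free_mod[OF X] by auto
  show ?thesis
  proof (cases "south_free x y")
    case True
    then have "x = 0" "y = 0" using west_free_south_free[OF X west_free] by auto
    then show ?thesis using west_free True by (simp add: own_def origin_block_def effective_rec[of 0 0])
  next
    case False
    then have nw: "\<not> west_free y x" by (simp add: south_free_def)
    have "inc ((y - Suc 0) mod 6) = y mod 6" and "0 < y"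
      using pos_pred_mod[OF nw] mod_less_divisor[of 6 y] by (auto simp: inc_def)
    moreover have "origin_block x y \<longleftrightarrow> origin_block x (y - Suc 0) \<and> (y - Suc 0) mod 6 \<noteq> 5"
      using pos_pred_mod[OF nw] by (auto simp: origin_block_def div6_pred split: if_splits)
    ultimately show ?thesis
      using west_free False nd by (auto simp: own_def effective_rec[of x y])
  qed
qed

text \<open>The induction works because the crossing in the cell (4,4) of a block receives what the whole
  block receives and sends what the whole block sends.\<close>

lemma wire_step:
  "carpet x y \<Longrightarrow> wire_E x y = gate_E (effective x y) (from_W x y) (from_S x y) \<and> wire_N x y = gate_N (effective x y) (from_W x y) (from_S x y)"
proof (induction x y rule: digit_induct)
  case (digit x y)
  let ?X = "x div 6" and ?Y = "y div 6"
  note X = digit.prems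
  note X' = carpet_div[OF X]
  note hole = carpet_hole[OF X]
  note W = west_free_rec[OF X] and S = south_free_rec[OF X]
  note W' = west_free_rec[OF X'] and S' = south_free_rec[OF X']
  have posx: "x mod 6 \<noteq> 0 \<Longrightarrow> 0 < x" "y mod 6 \<noteq> 0 \<Longrightarrow> 0 < y" by (auto intro: gr0I)
  have posX: "\<not> west_free ?X ?Y \<Longrightarrow> 0 < x" "\<not> south_free ?X ?Y \<Longrightarrow> 0 < y"
    by (auto simp: west_free_def south_free_def intro: gr0I)
  have merge_own: "merge_own (if west_free ?X ?Y then Nul else if digits ?X ?Y = (4, 4) then set_effective (effective ?X ?Y) (own (?X - 1) ?Y) else own (?X - 1) ?Y)
            (if south_free ?X ?Y then Nul else own ?X (?Y - 1)) = own ?X ?Y"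
    by (rule merge_own_eq[OF X'])
  note pX = pos_pred_mod[of ?X ?Y] pos_pred_mod[of ?Y ?X]
  note rules = from_W_def from_S_def wire_E.simps[of x y] wire_N.simps[of x y] wire_E.simps[of "x - Suc 0" y]
     wire_N.simps[of x "y - Suc 0"] mod6_pred div6_pred effective_rec[of x y] gate_E_def gate_N_def W S Let_def
  show ?case
  proof (cases "digits x y = (4, 4)")
    case True
    then show ?thesis
      using digit.IH[OF _ X'] posx by (simp add: rules)
  next
    case False
    \<comment> \<open>Singled out are the merging cell, the cells where column 0 crosses rows 1 and
      4, and the crossings (5,4) and (4,5) near the corner; all else is unfolding.\<close>
    consider "digits x y = (1, 1)" | "y mod 6 = 1" "x mod 6 = 0" | "y mod 6 = 4" "x mod 6 = 0" |
      "y mod 6 = 4" "x mod 6 = 5" | "y mod 6 = 5" "x mod 6 = 4" |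
      "digits x y \<noteq> (1, 1)" "\<not> (y mod 6 = 1 \<and> x mod 6 = 0)" "\<not> (y mod 6 = 4 \<and> x mod 6 = 0)"
      "\<not> (y mod 6 = 4 \<and> x mod 6 = 5)" "\<not> (y mod 6 = 5 \<and> x mod 6 = 4)"
      by auto
    then show ?thesis
    proof cases
      case 1
      then show ?thesis using posx merge_own by (simp add: rules cong: if_cong)
    next
      case 2
      \<comment> \<open>In this column row 1 still carries the western block's description, so
        blocks (4,4) and (4,1) are recognized by (3,4) and (3,1).\<close>
      have p1: "digits (?X - Suc 0) ?Y = (3, 4) \<longleftrightarrow> digits ?X ?Y = (4, 4)"
        "digits (?X - Suc 0) ?Y = (3, 1) \<longleftrightarrow> digits ?X ?Y = (4, 1)" if "\<not> west_free ?X ?Y"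
        using pX(1)[OF that] by (cases ?X rule: mod6_cases; auto)+
      have p2: "\<not> south_free ?X ?Y \<and> aux ?X (?Y - Suc 0) = Ax (effective ?X ?Y)" if "digits ?X ?Y = (4, 4)"
        using that S' by (simp add: aux_def mod6_pred div6_pred effective_rec[of ?X ?Y])
      have p3: "(if south_free ?X ?Y then Nul else aux ?X (?Y - Suc 0)) = aux ?X ?Y \<and> digits ?X ?Y \<noteq> (4, 1)"
        if "west_free ?X ?Y"
        using west_free_mod[OF X' that] S' by (auto simp: aux_def mod6_pred div6_pred)
      have p4: "digits ?X ?Y \<noteq> (4, 1) \<Longrightarrow> aux ?X ?Y = Nul" if "\<not> west_free ?X ?Y"
        using that W' by (auto simp: aux_def)
      show ?thesis
        using 2 posx posX p1 p2 p3 p4 by (cases "west_free ?X ?Y"; cases "south_free ?X ?Y") (auto simp: rules)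
    next
      case 3
      have "\<not> west_free ?X ?Y \<and> wire_E (?X - Suc 0) ?Y = own (?X div 6) (?Y div 6)
          \<and> aux ?X ?Y = Ax (effective (?X div 6) (?Y div 6))" if "digits ?X ?Y = (4, 1)"
        using that W' by (simp add: aux_def wire_E.simps[of "?X - Suc 0" ?Y] mod6_pred div6_pred)
      then show ?thesis
        using 3 posx posX by (cases "west_free ?X ?Y"; cases "digits ?X ?Y = (4, 1)") (auto simp: rules)
    next
      \<comment> \<open>In a block with address (5,5) the corner needs the content of the parent's
        row 5, which the block carries on its own row 4.\<close>
      case 4
      then show ?thesis using posx corner_own_rec[of ?X ?Y] wire_E.simps[of ?X ?Y] by (simp add: rules)
    next
      case 5
      then show ?thesis using posx corner_own_rec[of ?X ?Y] wire_N.simps[of ?X ?Y] by (simp add: rules)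
    next
      case 6
      then show ?thesis using False posx posX hole
        by (cases x rule: mod6_cases; cases y rule: mod6_cases) (simp_all add: rules)
    qed
  qed
qed

section \<open>Looking ahead\<close>

lemma pred_eqs: "\<not> west_free x y \<Longrightarrow> Suc (x - Suc 0) = x" "\<not> south_free x y \<Longrightarrow> Suc (y - Suc 0) = y"
  "\<not> west_free x y \<Longrightarrow> carpet (x - Suc 0) y" "\<not> south_free x y \<Longrightarrow> carpet x (y - Suc 0)"
  by (auto simp: west_free_def south_free_iff)

lemma cpos_corner_own: "cpos (corner_own x y) = case_prod digits (corner_block x y)"
  by (simp add: corner_own_def split: prod.split)

lemma corner_block_swap_digits: "case_prod digits (corner_block y x) = prod.swap (case_prod digits (corner_block x y))"
  unfolding corner_block_sym[of y x] by (cases "corner_block x y") simp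

text \<open>At address (0,5) outside the origin's block, the topmost row merely continues the
  reversed row of the parent.\<close>

fun starts_row :: "content \<Rightarrow> bool" where
  "starts_row (Own r w s b e) \<longleftrightarrow> w \<and> \<not> s \<and> \<not> (r = (0, 5) \<and> \<not> b)" | "starts_row _ \<longleftrightarrow> False"

fun starts_col :: "content \<Rightarrow> bool" where
  "starts_col (Own r w s b e) \<longleftrightarrow> s \<and> \<not> w \<and> \<not> (r = (5, 0) \<and> \<not> b)" | "starts_col _ \<longleftrightarrow> False"

text \<open>By \<open>row_start_rec\<close>, this is \<open>row_start\<close> at the north-east cell
  of the block.\<close>

definition starts :: "nat \<Rightarrow> nat \<Rightarrow> bool" where
  "starts x y \<longleftrightarrow> south_fed x y \<and> \<not> rev_row x y \<or> row_start x y"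

text \<open>A block (5,5) is never \<open>south_fed\<close> and defers to its parent, just as
  \<open>corner_own\<close> does. A \<open>south_fed\<close> block in row 5 has a parent without
  western neighbour, which by \<open>west_free_south_free\<close> is \<open>south_fed\<close> unless
  it contains the origin.\<close>

lemma starts_row_corner_own: "carpet x y \<Longrightarrow> starts_row (corner_own x y) \<longleftrightarrow> starts x y"
proof (induction x y rule: digit_induct)
  case (digit x y)
  let ?x = "x div 6" and ?y = "y div 6"
  note X = carpet_div[OF digit.prems]
  show ?case
  proof (cases "digits x y = (5, 5)")
    case True
    then have m: "x mod 6 = 5" "y mod 6 = 5" by auto
    have "\<not> south_fed x y" using west_free_mod[OF digit.prems] m by (auto simp: south_fed_def)
    then show ?thesis
      using digit.IH[OF mod6_5_nz[OF m(2)] X] row_start_rec[OF m] m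
      by (auto simp: corner_own_rec[of x y] starts_def)
  next
    case False
    have "rev_row x y \<longleftrightarrow> digits x y = (0, 5) \<and> \<not> origin_block x y" if t: "south_fed x y"
    proof (cases "y mod 6 = 5")
      case y5: True
      then have w: "x mod 6 = 0" "west_free ?x ?y"
        using t west_free_rec[OF digit.prems] by (auto simp: south_fed_def split: if_splits)
      show ?thesis
      proof (cases "origin_block x y")
        case True
        then have z: "?x = 0" "?y = 0" by (auto simp: origin_block_def)
        have "\<not> south_fed 0 0" by (simp add: south_fed_def south_free_def west_free_def)
        moreover have "\<not> rev_row 0 0" using rev_row_mod[of 0 0] by auto
        ultimately show ?thesis using rev_row_rec[OF y5, of x] z True by simp
      next
        case no: False
        then have "\<not> south_free ?x ?y" using west_free_south_free[OF X w(2)] by (auto simp: origin_block_def)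
        then show ?thesis using rev_row_rec[OF y5, of x] w y5 no by (auto simp: south_fed_def)
      qed
    qed (auto dest: rev_row_mod)
    then show ?thesis
      using False row_start_mod[of x y] by (auto simp: corner_own_rec[of x y] starts_def own_def south_fed_def)
  qed
qed

lemma starts_col_own: "starts_col (own x y) = starts_row (own y x)"
  by (auto simp: own_def south_free_def origin_block_def)

lemma starts_col_corner_own: "carpet x y \<Longrightarrow> starts_col (corner_own x y) \<longleftrightarrow> starts y x"
  using starts_row_corner_own[of y x] corner_block_sym[of x y] carpet_sym[of x y]
  by (simp add: corner_own_def starts_col_own split: prod.splits)

text \<open>Seen from a north-east corner with address \<open>r\<close> and northern neighbour missing iff \<open>b\<close>:
  whether the cell to the east lacks a northern neighbour.\<close>

definition lookN :: "nat \<times> nat \<Rightarrow> bool \<Rightarrow> bool" where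
  "lookN r b \<longleftrightarrow> r = (1, 1) \<or> r = (2, 1) \<or> fst r < 5 \<and> snd r = 5 \<and> b"

text \<open>With this a cell that begins a block learns from the west whether a cell lies to its
  north. East of (1,1) and (2,1) lies the lower rim of the hole; in row 5 both cells face the same
  northern block.\<close>

lemma carpet_NE:
  "carpet x y \<Longrightarrow> carpet (Suc x) y \<Longrightarrow> \<not> carpet (Suc x) (Suc y) \<longleftrightarrow> lookN (case_prod digits (corner_block x y)) (\<not> carpet x (Suc y))"
proof (induction x y rule: digit_induct)
  case (digit x y)
  note X = digit.prems
  note rules = carpet_rec[of x y] carpet_rec[of "Suc x" y] carpet_rec[of x "Suc y"] carpet_rec[of "Suc x" "Suc y"]
  show ?case
  proof (cases "digits x y = (5, 5)")
    case True
    then have m: "x mod 6 = 5" "y mod 6 = 5" by auto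
    then have "carpet (Suc (x div 6)) (y div 6)" using carpet_E5 X by blast
    then show ?thesis
      using digit.IH[OF mod6_5_nz[OF m(2)] carpet_div[OF X(1)]] m rules
      by (simp add: corner_block.simps[of x y] mod6_Suc div6_Suc)
  next
    case False
    then have v: "corner_block x y = (x, y)" by (auto simp: corner_block.simps[of x y])
    then show ?thesis
      using X False unfolding rules v lookN_def
      by (cases x rule: mod6_cases; cases y rule: mod6_cases) (simp_all add: mod6_Suc div6_Suc)
  qed
qed

text \<open>Seen from (3,1), the north-eastern cell is (4,2), the foot of the hole's eastern
  wall.\<close>

lemma carpet_NE_west_free:
  "carpet x y \<Longrightarrow> carpet (Suc x) y \<Longrightarrow> carpet (Suc x) (Suc y) \<Longrightarrow>
    \<not> carpet x (Suc y) \<longleftrightarrow> case_prod digits (corner_block x y) = (3, 1)"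
proof (induction x y rule: digit_induct)
  case (digit x y)
  note X = digit.prems
  note rules = carpet_rec[of x y] carpet_rec[of "Suc x" y] carpet_rec[of x "Suc y"] carpet_rec[of "Suc x" "Suc y"]
  show ?case
  proof (cases "digits x y = (5, 5)")
    case True
    then have m: "x mod 6 = 5" "y mod 6 = 5" by auto
    then have "carpet (Suc (x div 6)) (y div 6)" "carpet (Suc (x div 6)) (Suc (y div 6))"
      using X rules by (simp_all add: mod6_Suc div6_Suc)
    then show ?thesis
      using digit.IH[OF mod6_5_nz[OF m(2)] carpet_div[OF X(1)]] m rules
      by (simp add: corner_block.simps[of x y] mod6_Suc div6_Suc)
  next
    case False
    then have v: "corner_block x y = (x, y)" by (auto simp: corner_block.simps[of x y])
    then show ?thesis
      using X False unfolding rules v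
      by (cases x rule: mod6_cases; cases y rule: mod6_cases) (simp_all add: mod6_Suc div6_Suc)
  qed
qed

text \<open>Address (4,3) is the top of a hole's eastern wall: the block above it, (4,4), has a
  western neighbour again.\<close>

lemma west_free_N_rev_row: "carpet x y \<Longrightarrow> rev_row x y \<Longrightarrow>
  west_free (x div 6) (Suc (y div 6)) \<longleftrightarrow> west_free (x div 6) (y div 6) \<and> case_prod digits (rev_block x y) \<noteq> (4, 3)"
proof (induction x y rule: digit_induct)
  case (digit x y)
  let ?x = "x div 6" and ?y = "y div 6"
  note X = carpet_div[OF digit.prems(1)]
  have y5: "y mod 6 = 5" using digit.prems(2) by (rule rev_row_mod)
  have NX: "carpet ?x (Suc ?y)" using rev_row_N[OF digit.prems] carpet_N5[OF digit.prems(1) y5] by simp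
  show ?case
  proof (cases "south_fed ?x ?y \<and> \<not> rev_row ?x ?y")
    case True
    then have q: "rev_block x y = (?x, ?y)" by (subst rev_block.simps) auto
    have w: "west_free ?x ?y" using True by (auto simp: south_fed_def)
    have "?y mod 6 = 5 \<Longrightarrow> ?x mod 6 = 0 \<Longrightarrow> west_free (?x div 6) (Suc (?y div 6))"
    proof -
      assume a: "?y mod 6 = 5" "?x mod 6 = 0"
      then have "west_free (?x div 6) (?y div 6)" using w west_free_rec[OF X] by simp
      moreover have "\<not> south_fed (?x div 6) (?y div 6)" using True rev_row_rec[OF a(1), of ?x] by simp
      ultimately have "?x div 6 = 0" using west_free_south_free[OF carpet_div[OF X]] by (auto simp: south_fed_def)
      then show ?thesis by (simp add: west_free_def)
    qed
    then show ?thesis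
      using w west_free_rec[OF X] west_free_rec[OF NX] unfolding q
      by (cases ?y rule: mod6_cases) (auto simp: mod6_Suc div6_Suc split: if_splits)
  next
    case False
    then have r: "rev_row ?x ?y" using digit.prems(2) rev_row_rec[OF y5, of x] by auto
    then have q: "rev_block x y = rev_block ?x ?y" using y5 by (subst rev_block.simps) auto
    have Y5: "?y mod 6 = 5" using r by (rule rev_row_mod)
    show ?thesis
      using digit.IH[OF mod6_5_nz[OF y5] X r] west_free_rec[OF X] west_free_rec[OF NX] Y5 unfolding q
      by (auto simp: mod6_Suc div6_Suc)
  qed
qed

definition out_N :: "nat \<Rightarrow> nat \<Rightarrow> bool" where
  "out_N x y \<longleftrightarrow> carpet x (Suc y) \<and> \<not> rev_col x (Suc y)"

text \<open>The glue to the north has strength 2, being the only input of the northern neighbour.\<close>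

definition doubleN :: "nat \<Rightarrow> nat \<Rightarrow> bool" where
  "doubleN x y \<longleftrightarrow> out_N x y \<and> (\<not> rev_row x (Suc y) \<and> west_free x (Suc y) \<or> row_start x (Suc y))"

lemma out_N_iff: "carpet x y \<Longrightarrow> out_N x y \<longleftrightarrow> carpet x (Suc y) \<and> \<not> (rev_col x y \<and> \<not> col_start x y)"
  using rev_col_N[of x y] by (auto simp: out_N_def)

text \<open>In column 0 the northern neighbour shares the missing western side, except when it lies
  on a reversed topmost row or in the next block. Elsewhere a sole southern input occurs only along
  the hole's eastern wall, above (4,1) and (4,2), and at a row start, above (5,4).\<close>

lemma doubleN_iff:
  assumes X: "carpet x y"
  shows "doubleN x y \<longleftrightarrow> out_N x y \<and>
    (if x mod 6 = 0 then
       if y mod 6 < 4 then west_free x y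
       else if y mod 6 = 4 then west_free x y \<and> origin_block x y
       else if rev_row x y then west_free x y \<and> case_prod digits (rev_block x y) \<noteq> (4, 3)
       else west_free x y \<or> case_prod digits (corner_block (x div 6 - 1) (y div 6)) = (3, 1)
     else digits x y = (4, 1) \<or> digits x y = (4, 2) \<or> digits x y = (5, 4) \<and> starts (x div 6) (y div 6))"
  (is "_ \<longleftrightarrow> _ \<and> ?C")
proof (cases "out_N x y")
  case out_N: True
  let ?x = "x div 6" and ?y = "y div 6"
  note X' = carpet_div[OF X]
  have NX: "carpet x (Suc y)" using out_N by (simp add: out_N_def)
  note wN = west_free_rec[OF NX]
  have "(\<not> rev_row x (Suc y) \<and> west_free x (Suc y) \<or> row_start x (Suc y)) \<longleftrightarrow> ?C"
  proof (cases "y mod 6 = 5")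
    case y5: True
    have nr: "\<not> rev_row x (Suc y)" "\<not> row_start x (Suc y)"
      using y5 rev_row_mod[of x "Suc y"] row_start_mod[of x "Suc y"] by (auto simp: mod6_Suc)
    show ?thesis
    proof (cases "x mod 6 = 0")
      case x0: True
      have wN': "west_free x (Suc y) = west_free ?x (Suc ?y)" using wN x0 y5 by (simp add: div6_Suc)
      have w: "west_free x y = west_free ?x ?y" using west_free_rec[OF X] x0 by simp
      show ?thesis
      proof (cases "rev_row x y")
        case True
        then show ?thesis using west_free_N_rev_row[OF X True] wN' w nr x0 y5 by simp
      next
        case nrev: False
        show ?thesis
        proof (cases "west_free x y")
          case True
          then have "\<not> south_fed ?x ?y" using nrev rev_row_rec[OF y5, of x] by auto
          then have "?x = 0" using True w west_free_south_free[OF X'] by (auto simp: south_fed_def)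
          then have "west_free ?x (Suc ?y)" by (simp add: west_free_def)
          then show ?thesis using True wN' nr x0 y5 nrev by simp
        next
          case False
          then have nw: "\<not> west_free ?x ?y" using w by simp
          have "carpet ?x (Suc ?y)" using carpet_N5[OF X y5] NX by simp
          then have "\<not> carpet (?x - 1) (Suc ?y) \<longleftrightarrow> case_prod digits (corner_block (?x - 1) ?y) = (3, 1)"
            using carpet_NE_west_free[of "?x - 1" ?y] pred_eqs(1,3)[OF nw] X' by simp
          moreover have "west_free ?x (Suc ?y) \<longleftrightarrow> \<not> carpet (?x - 1) (Suc ?y)"
            using nw by (auto simp: west_free_def)
          ultimately show ?thesis using False wN' nr x0 y5 nrev by simp
        qed
      qed
    next
      case False
      then show ?thesis using nr wN y5 by (auto simp: mod6_Suc)
    qed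
  next
    case yn5: False
    have div: "Suc y div 6 = ?y" using yn5 by (simp add: div6_Suc)
    show ?thesis
    proof (cases "y mod 6 = 4")
      case y4: True
      then have S5: "Suc y mod 6 = 5" by (simp add: mod6_Suc)
      have rv: "rev_row x (Suc y) \<longleftrightarrow> south_fed ?x ?y \<or> rev_row ?x ?y" using rev_row_rec[OF S5, of x] div by simp
      have cell_state: "row_start x (Suc y) \<longleftrightarrow> x mod 6 = 5 \<and> starts ?x ?y"
        using row_start_rec[OF _ S5, of x] row_start_mod[of x "Suc y"] div by (auto simp: starts_def)
      have "west_free ?x ?y \<Longrightarrow> \<not> (south_fed ?x ?y \<or> rev_row ?x ?y) \<longleftrightarrow> ?x = 0 \<and> ?y = 0"
        using west_free_south_free[OF X'] rev_row_mod[of 0 0] by (auto simp: south_fed_def south_free_def west_free_def)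
      then show ?thesis
        using wN rv cell_state S5 div y4 west_free_rec[OF X] by (auto simp: origin_block_def)
    next
      case False
      then have "y mod 6 < 4" "\<not> rev_row x (Suc y)" "\<not> row_start x (Suc y)"
        using yn5 mod_less_divisor[of 6 y] rev_row_mod[of x "Suc y"] row_start_mod[of x "Suc y"]
        by (auto simp: mod6_Suc)
      then show ?thesis
        using wN west_free_rec[OF X] div carpet_hole[OF X]
        by (cases y rule: mod6_cases) (auto simp: mod6_Suc)
    qed
  qed
  then show ?thesis using out_N by (simp add: doubleN_def)
qed (simp add: doubleN_def)

section \<open>The state of a cell\<close>

definition row_own :: "nat \<Rightarrow> nat \<Rightarrow> content" where
  "row_own x y = case_prod own (rev_block x y)"

definition col_own :: "nat \<Rightarrow> nat \<Rightarrow> content" where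
  "col_own x y = case_prod own (prod.swap (rev_block y x))"

text \<open>On a reversed row the slot of the eastward wire is reused for the description that is
  passed westwards.\<close>

definition send_E :: "nat \<Rightarrow> nat \<Rightarrow> content" where
  "send_E x y = (if rev_row x y then row_own x y else wire_E x y)"

definition send_N :: "nat \<Rightarrow> nat \<Rightarrow> content" where
  "send_N x y = (if rev_col x y then col_own x y else wire_N x y)"

datatype cell_state = St (s_digits: "nat \<times> nat") (s_origin_block: bool) (s_west_free: bool) (s_south_free: bool) (s_rimN: bool) (s_rimE: bool)
  (s_rev_row: bool) (s_row_start: bool) (s_rev_col: bool) (s_col_start: bool) (s_E: content) (s_N: content) (s_aux: content)
  (s_doubleN: bool) (s_doubleE: bool)

definition state :: "nat \<Rightarrow> nat \<Rightarrow> cell_state" where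
  "state x y = St (digits x y) (origin_block x y) (west_free x y) (south_free x y) (\<not> carpet x (Suc y)) (\<not> carpet (Suc x) y)
     (rev_row x y) (row_start x y) (rev_col x y) (col_start x y) (send_E x y) (send_N x y) (aux x y) (doubleN x y) (doubleN y x)"

fun reads :: "nat \<Rightarrow> nat \<Rightarrow> dir \<Rightarrow> bool" where
  "reads x y W \<longleftrightarrow> \<not> rev_row x y \<and> \<not> west_free x y"
| "reads x y S \<longleftrightarrow> \<not> rev_col x y \<and> \<not> south_free x y"
| "reads x y E \<longleftrightarrow> rev_row x y \<and> \<not> row_start x y"
| "reads x y N \<longleftrightarrow> rev_col x y \<and> \<not> col_start x y"

definition opt :: "bool \<Rightarrow> 'a \<Rightarrow> 'a option" where
  "opt b a = (if b then Some a else None)"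

lemma opt_simps [simp]: "opt True a = Some a" "opt False a = None" "opt b a = None \<longleftrightarrow> \<not> b"
  by (auto simp: opt_def)

definition nbW :: "nat \<Rightarrow> nat \<Rightarrow> cell_state option" where "nbW x y = opt (reads x y W) (state (x - 1) y)"
definition nbS :: "nat \<Rightarrow> nat \<Rightarrow> cell_state option" where "nbS x y = opt (reads x y S) (state x (y - 1))"
definition nbE :: "nat \<Rightarrow> nat \<Rightarrow> cell_state option" where "nbE x y = opt (reads x y E) (state (Suc x) y)"
definition nbN :: "nat \<Rightarrow> nat \<Rightarrow> cell_state option" where "nbN x y = opt (reads x y N) (state x (Suc y))"

definition cE :: "cell_state option \<Rightarrow> content" where
  "cE w = (case w of None \<Rightarrow> Nul | Some u \<Rightarrow> s_E u)"

definition cN :: "cell_state option \<Rightarrow> content" where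
  "cN s = (case s of None \<Rightarrow> Nul | Some u \<Rightarrow> s_N u)"

text \<open>The functions \<open>n_...\<close> compute the components of a state from the states \<open>w\<close>, \<open>s\<close>, \<open>e\<close>, \<open>n\<close>
  of the western, southern, eastern and northern neighbour, each present only if it is an input.\<close>

definition n_digits :: "cell_state option \<Rightarrow> cell_state option \<Rightarrow> nat \<times> nat" where
  "n_digits w s = (case w of Some u \<Rightarrow> (inc (fst (s_digits u)), snd (s_digits u))
     | None \<Rightarrow> (fst (s_digits (the s)), inc (snd (s_digits (the s)))))"

text \<open>A cell with address (5,5) always has a western neighbour; if it reads neither this nor
  the eastern one, a reversed row starts there.\<close>

definition n_row_start :: "cell_state option \<Rightarrow> cell_state option \<Rightarrow> cell_state option \<Rightarrow> bool" where
  "n_row_start w s e \<longleftrightarrow> w = None \<and> e = None \<and> n_digits w s = (5, 5)"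

definition n_col_start :: "cell_state option \<Rightarrow> cell_state option \<Rightarrow> cell_state option \<Rightarrow> bool" where
  "n_col_start w s n \<longleftrightarrow> s = None \<and> n = None \<and> n_digits w s = (5, 5)"

definition n_rev_row :: "cell_state option \<Rightarrow> cell_state option \<Rightarrow> cell_state option \<Rightarrow> bool" where
  "n_rev_row w s e \<longleftrightarrow> e \<noteq> None \<or> n_row_start w s e"

definition n_rev_col :: "cell_state option \<Rightarrow> cell_state option \<Rightarrow> cell_state option \<Rightarrow> bool" where
  "n_rev_col w s n \<longleftrightarrow> n \<noteq> None \<or> n_col_start w s n"

definition n_west_free :: "cell_state option \<Rightarrow> cell_state option \<Rightarrow> cell_state option \<Rightarrow> bool" where
  "n_west_free w s e \<longleftrightarrow> (if n_rev_row w s e then fst (n_digits w s) = 0 \<and> s_west_free (the s) else w = None)"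

definition n_south_free :: "cell_state option \<Rightarrow> cell_state option \<Rightarrow> cell_state option \<Rightarrow> bool" where
  "n_south_free w s n \<longleftrightarrow> (if n_rev_col w s n then snd (n_digits w s) = 0 \<and> s_south_free (the w) else s = None)"

definition n_origin_block :: "cell_state option \<Rightarrow> cell_state option \<Rightarrow> bool" where
  "n_origin_block w s \<longleftrightarrow> w \<noteq> None \<and> fst (n_digits w s) \<noteq> 0 \<and> s_origin_block (the w) \<or>
     s \<noteq> None \<and> snd (n_digits w s) \<noteq> 0 \<and> s_origin_block (the s)"

definition n_rimN :: "cell_state option \<Rightarrow> cell_state option \<Rightarrow> cell_state option \<Rightarrow> bool" where
  "n_rimN w s e \<longleftrightarrow> \<not> n_rev_row w s e \<and> (n_digits w s = (2, 1) \<or> n_digits w s = (3, 1) \<or>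
     snd (n_digits w s) = 5 \<and> w \<noteq> None \<and>
       (if fst (n_digits w s) \<noteq> 0 then s_rimN (the w) else lookN (cpos (cE w)) (s_rimN (the w))))"

definition n_rimE :: "cell_state option \<Rightarrow> cell_state option \<Rightarrow> cell_state option \<Rightarrow> bool" where
  "n_rimE w s n \<longleftrightarrow> \<not> n_rev_col w s n \<and> (n_digits w s = (1, 2) \<or> n_digits w s = (1, 3) \<or>
     fst (n_digits w s) = 5 \<and> s \<noteq> None \<and>
       (if snd (n_digits w s) \<noteq> 0 then s_rimE (the s) else lookN (prod.swap (cpos (cN s))) (s_rimE (the s))))"

definition n_effective :: "cell_state option \<Rightarrow> cell_state option \<Rightarrow> nat \<times> nat" where
  "n_effective w s = (if n_digits w s = (4, 4) then ceff (s_aux (the s)) else n_digits w s)"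

definition n_E :: "cell_state option \<Rightarrow> cell_state option \<Rightarrow> cell_state option \<Rightarrow> content" where
  "n_E w s e = (if n_rev_row w s e then (case e of Some u \<Rightarrow> s_E u | None \<Rightarrow> cN s)
     else gate_E (n_effective w s) (cE w) (cN s))"

definition n_N :: "cell_state option \<Rightarrow> cell_state option \<Rightarrow> cell_state option \<Rightarrow> content" where
  "n_N w s n = (if n_rev_col w s n then (case n of Some u \<Rightarrow> s_N u | None \<Rightarrow> cE w)
     else gate_N (n_effective w s) (cE w) (cN s))"

definition n_aux :: "cell_state option \<Rightarrow> cell_state option \<Rightarrow> content" where
  "n_aux w s = (if n_digits w s = (4, 1) then Ax (ceff (cE w))
     else if n_digits w s = (4, 2) \<or> n_digits w s = (4, 3) then s_aux (the s) else Nul)"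

definition n_doubleN :: "cell_state option \<Rightarrow> cell_state option \<Rightarrow> cell_state option \<Rightarrow> cell_state option \<Rightarrow> bool" where
  "n_doubleN w s e n \<longleftrightarrow> (case n_digits w s of (i, j) \<Rightarrow>
     \<not> n_rimN w s e \<and> \<not> (n_rev_col w s n \<and> \<not> n_col_start w s n) \<and>
     (if i = 0 then
        if j < 4 then n_west_free w s e
        else if j = 4 then n_west_free w s e \<and> n_origin_block w s
        else if n_rev_row w s e then n_west_free w s e \<and> cpos (n_E w s e) \<noteq> (4, 3)
        else w = None \<or> cpos (cE w) = (3, 1)
      else (i, j) = (4, 1) \<or> (i, j) = (4, 2) \<or> (i, j) = (5, 4) \<and> starts_row (n_N w s n)))"

definition n_doubleE :: "cell_state option \<Rightarrow> cell_state option \<Rightarrow> cell_state option \<Rightarrow> cell_state option \<Rightarrow> bool" where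
  "n_doubleE w s e n \<longleftrightarrow> (case n_digits w s of (i, j) \<Rightarrow>
     \<not> n_rimE w s n \<and> \<not> (n_rev_row w s e \<and> \<not> n_row_start w s e) \<and>
     (if j = 0 then
        if i < 4 then n_south_free w s n
        else if i = 4 then n_south_free w s n \<and> n_origin_block w s
        else if n_rev_col w s n then n_south_free w s n \<and> cpos (n_N w s n) \<noteq> (3, 4)
        else s = None \<or> cpos (cN s) = (1, 3)
      else (i, j) = (1, 4) \<or> (i, j) = (2, 4) \<or> (i, j) = (4, 5) \<and> starts_col (n_E w s e)))"

definition next_state :: "cell_state option \<Rightarrow> cell_state option \<Rightarrow> cell_state option \<Rightarrow> cell_state option \<Rightarrow> cell_state" where
  "next_state w s e n = St (n_digits w s) (n_origin_block w s) (n_west_free w s e) (n_south_free w s n) (n_rimN w s e) (n_rimE w s n)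
     (n_rev_row w s e) (n_row_start w s e) (n_rev_col w s n) (n_col_start w s n) (n_E w s e) (n_N w s n) (n_aux w s)
     (n_doubleN w s e n) (n_doubleE w s e n)"

lemma rev_col_mod: "rev_col x y \<Longrightarrow> x mod 6 = 5"
  by (auto simp: rev_col_def dest: rev_row_mod)

lemma col_start_mod: "col_start x y \<Longrightarrow> x mod 6 = 5 \<and> y mod 6 = 5"
  by (auto simp: col_start_def dest: row_start_mod)

lemma col_start_rev_col: "col_start x y \<Longrightarrow> rev_col x y"
  by (simp add: col_start_def rev_col_def row_start_rev_row)

text \<open>So the cell beyond the eastern end of a reversed row may read its western neighbour as
  usual.\<close>

lemma row_start_send_E: "carpet x y \<Longrightarrow> row_start x y \<Longrightarrow> send_E x y = wire_E x y"
  using row_start_rev_block[of x y] row_start_mod[of x y] row_start_rev_row[of x y]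
  by (simp add: send_E_def row_own_def corner_own_def wire_E.simps[of x y])

lemma col_start_rev_block: "carpet x y \<Longrightarrow> col_start x y \<Longrightarrow> prod.swap (rev_block y x) = corner_block (x div 6) (y div 6)"
  using row_start_rev_block[of y x] corner_block_sym[of "x div 6" "y div 6"] carpet_sym[of x y] by (simp add: col_start_def)

lemma col_start_send_N: "carpet x y \<Longrightarrow> col_start x y \<Longrightarrow> send_N x y = wire_N x y"
  using col_start_rev_block[of x y] col_start_mod[of x y] col_start_rev_col[of x y]
  by (simp add: send_N_def col_own_def corner_own_def wire_N.simps[of x y])

section \<open>Computing the state of a cell from its inputs\<close>

locale cell =
  fixes x y :: nat
  assumes carpet: "carpet x y" and nz: "x \<noteq> 0 \<or> y \<noteq> 0"
begin

abbreviation (input) "w \<equiv> nbW x y"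
abbreviation (input) "s \<equiv> nbS x y"
abbreviation (input) "e \<equiv> nbE x y"
abbreviation (input) "n \<equiv> nbN x y"

lemma rev_row_facts: "rev_row x y \<Longrightarrow> \<not> rev_col x y \<and> \<not> south_free x y \<and> y mod 6 = 5"
  using rev_row_not_rev_col[OF carpet] rev_row_mod[of x y] south_free_mod[OF carpet] by auto

lemma rev_col_facts: "rev_col x y \<Longrightarrow> \<not> rev_row x y \<and> \<not> west_free x y \<and> x mod 6 = 5"
  using rev_row_not_rev_col[OF carpet] rev_col_mod[of x y] west_free_mod[OF carpet] by auto

text \<open>A reversed row still reads from the south and a reversed column from the west, so the
  address can always be continued.\<close>

lemma some_input: "reads x y W \<or> reads x y S"
  using rev_row_facts rev_col_facts west_free_south_free[OF carpet] nz by auto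

lemma the_w [simp]: "reads x y W \<Longrightarrow> the w = state (x - 1) y"
  and the_s [simp]: "reads x y S \<Longrightarrow> the s = state x (y - 1)"
  and w_None: "w = None \<longleftrightarrow> \<not> reads x y W" and s_None: "s = None \<longleftrightarrow> \<not> reads x y S"
  and e_None: "e = None \<longleftrightarrow> \<not> reads x y E" and n_None: "n = None \<longleftrightarrow> \<not> reads x y N"
  by (simp_all add: nbW_def nbS_def nbE_def nbN_def)

lemma mod_pred: "\<not> west_free x y \<Longrightarrow> inc ((x - Suc 0) mod 6) = x mod 6"
  "\<not> south_free x y \<Longrightarrow> inc ((y - Suc 0) mod 6) = y mod 6"
  using pos_pred_mod[of x y] pos_pred_mod[of y x] mod_less_divisor[of 6 x] mod_less_divisor[of 6 y]
  by (auto simp: inc_def south_free_def)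

lemma digits_next: "n_digits w s = digits x y"
  using some_input mod_pred by (cases "reads x y W") (auto simp: n_digits_def state_def nbW_def nbS_def)

lemma row_start_next: "n_row_start w s e = row_start x y"
  using row_start_mod[of x y] row_start_rev_row[of x y] west_free_mod[OF carpet]
  by (auto simp: n_row_start_def digits_next w_None e_None)

lemma col_start_next: "n_col_start w s n = col_start x y"
  using col_start_mod[of x y] col_start_rev_col[of x y] south_free_mod[OF carpet]
  by (auto simp: n_col_start_def digits_next s_None n_None)

lemma rev_row_next: "n_rev_row w s e = rev_row x y"
  using row_start_rev_row[of x y] by (auto simp: n_rev_row_def row_start_next e_None)

lemma rev_col_next: "n_rev_col w s n = rev_col x y"
  using col_start_rev_col[of x y] by (auto simp: n_rev_col_def col_start_next n_None)

lemma west_free_next: "n_west_free w s e = west_free x y"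
proof (cases "rev_row x y")
  case True
  then have f: "\<not> rev_col x y" "\<not> south_free x y" "y mod 6 = 5" using rev_row_facts by auto
  have "west_free x y \<longleftrightarrow> x mod 6 = 0 \<and> west_free x (y - 1)"
    using west_free_rec[OF carpet] west_free_rec[OF pred_eqs(4)[OF f(2)]] f by (auto simp: div6_pred)
  then show ?thesis using True f by (simp add: n_west_free_def rev_row_next digits_next state_def)
next
  case False
  then show ?thesis by (simp add: n_west_free_def rev_row_next w_None)
qed

lemma south_free_next: "n_south_free w s n = south_free x y"
proof (cases "rev_col x y")
  case True
  then have f: "\<not> rev_row x y" "\<not> west_free x y" "x mod 6 = 5" using rev_col_facts by auto
  have "south_free x y \<longleftrightarrow> y mod 6 = 0 \<and> south_free (x - 1) y"
    using south_free_rec[OF carpet] south_free_rec[OF pred_eqs(3)[OF f(2)]] f by (auto simp: div6_pred)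
  then show ?thesis using True f by (simp add: n_south_free_def rev_col_next digits_next state_def)
next
  case False
  then show ?thesis by (simp add: n_south_free_def rev_col_next s_None)
qed

lemma origin_block_next: "n_origin_block w s = origin_block x y"
proof
  assume "n_origin_block w s"
  then show "origin_block x y"
    by (auto simp: n_origin_block_def digits_next w_None s_None state_def origin_block_def div6_pred)
next
  assume o: "origin_block x y"
  then have q: "x div 6 = 0" "y div 6 = 0" by (auto simp: origin_block_def)
  have "\<not> south_fed 0 0" by (simp add: south_fed_def south_free_def west_free_def)
  moreover have "\<not> rev_row 0 0" using rev_row_mod[of 0 0] by auto
  ultimately have r: "\<not> rev_row x y" "\<not> rev_col x y"
    using rev_row_mod[of x y] rev_row_mod[of y x] rev_row_rec[of y x] rev_row_rec[of x y] unfolding rev_col_def q by blast+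
  have "west_free x y \<Longrightarrow> \<not> south_free x y" using west_free_south_free[OF carpet] nz by auto
  moreover have "x = 0 \<Longrightarrow> west_free x y" "y = 0 \<Longrightarrow> south_free x y" by (auto simp: west_free_def south_free_iff)
  moreover have "x mod 6 = x" "y mod 6 = y" using q by presburger+
  moreover have "origin_block (x - 1) y" "origin_block x (y - 1)"
    using q by (auto simp: origin_block_def div6_pred)
  ultimately show "n_origin_block w s"
    using r unfolding n_origin_block_def digits_next w_None s_None
    by (cases "west_free x y") (simp_all add: state_def, (metis gr0I)+)
qed

text \<open>A western neighbour on a reversed row that does not contain the cell is the start of
  that row and still shows its ordinary wire.\<close>

lemma cE_eq: "cE w = (if rev_row x y then Nul else from_W x y)"
proof (cases "reads x y W")
  case True
  then have nw: "\<not> west_free x y" and nr: "\<not> rev_row x y" by auto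
  have "\<not> rev_row (x - 1) y \<or> row_start (x - 1) y"
    using rev_row_E[of "x - 1" y] pred_eqs(1,3)[OF nw] carpet nr by auto
  then have "send_E (x - 1) y = wire_E (x - 1) y"
    using row_start_send_E[of "x - 1" y] pred_eqs(3)[OF nw] by (auto simp: send_E_def)
  then show ?thesis using nw nr by (simp add: cE_def nbW_def state_def from_W_def)
qed (auto simp: cE_def from_W_def nbW_def opt_def)

lemma cN_eq: "cN s = (if rev_col x y then Nul else from_S x y)"
proof (cases "reads x y S")
  case True
  then have nw: "\<not> south_free x y" and nr: "\<not> rev_col x y" by auto
  have "\<not> rev_col x (y - 1) \<or> col_start x (y - 1)"
    using rev_col_N[of x "y - 1"] pred_eqs(2,4)[OF nw] carpet nr by auto
  then have "send_N x (y - 1) = wire_N x (y - 1)"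
    using col_start_send_N[of x "y - 1"] pred_eqs(4)[OF nw] by (auto simp: send_N_def)
  then show ?thesis using nw nr by (simp add: cN_def nbS_def state_def from_S_def)
qed (auto simp: cN_def from_S_def nbS_def opt_def)

lemma from_W_corner: "x mod 6 = 0 \<Longrightarrow> y mod 6 = 5 \<Longrightarrow> \<not> west_free x y \<Longrightarrow> from_W x y = corner_own (x div 6 - 1) (y div 6)"
  using pos_pred_mod[of x y] by (simp add: from_W_def wire_E.simps[of "x - Suc 0" y] div6_pred)

lemma from_S_corner: "y mod 6 = 0 \<Longrightarrow> x mod 6 = 5 \<Longrightarrow> \<not> south_free x y \<Longrightarrow> from_S x y = corner_own (x div 6) (y div 6 - 1)"
  using pos_pred_mod[of y x] by (simp add: from_S_def wire_N.simps[of x "y - Suc 0"] div6_pred south_free_def)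

lemma rimN_next: "n_rimN w s e \<longleftrightarrow> \<not> carpet x (Suc y)"
proof (cases "rev_row x y")
  case True
  then show ?thesis using rev_row_N[OF carpet True] by (simp add: n_rimN_def rev_row_next)
next
  case nr: False
  show ?thesis
  proof (cases "y mod 6 = 5")
    case y5: True
    show ?thesis
    proof (cases "west_free x y")
      case True
      then show ?thesis using west_free_N[OF carpet True] y5 nr by (simp add: n_rimN_def digits_next rev_row_next w_None)
    next
      case nw: False
      let ?x = "x div 6" and ?y = "y div 6"
      have P: "carpet (x - 1) y" by (simp add: pred_eqs nw)
      show ?thesis
      proof (cases "x mod 6 = 0")
        case x0: True
        have nw': "\<not> west_free ?x ?y" using nw west_free_rec[OF carpet] x0 by simp
        have "\<not> carpet (Suc (?x - 1)) (Suc ?y) \<longleftrightarrow>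
            lookN (case_prod digits (corner_block (?x - 1) ?y)) (\<not> carpet (?x - 1) (Suc ?y))"
          using pred_eqs(1,3)[OF nw'] carpet_div[OF carpet] by (intro carpet_NE) simp_all
        moreover have "carpet x (Suc y) = carpet ?x (Suc ?y)" by (rule carpet_N5[OF carpet y5])
        moreover have "carpet (x - 1) (Suc y) = carpet (?x - 1) (Suc ?y)"
          using carpet_N5[OF P y5] x0 by (simp add: div6_pred)
        ultimately show ?thesis
          using nr nw x0 y5 pred_eqs(1)[OF nw'] from_W_corner[OF x0 y5 nw]
          by (simp add: n_rimN_def digits_next rev_row_next w_None cE_eq state_def cpos_corner_own)
      next
        case False
        then have "carpet x (Suc y) = carpet (x - 1) (Suc y)"
          using carpet_N5[OF carpet y5] carpet_N5[OF P y5] by (simp add: div6_pred)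
        then show ?thesis using False nr nw y5
          by (simp add: n_rimN_def digits_next rev_row_next w_None state_def)
      qed
    qed
  next
    case False
    then show ?thesis
      using carpet_N[OF carpet] carpet_hole[OF carpet] nr by (auto simp: n_rimN_def digits_next rev_row_next)
  qed
qed

lemma rimE_next: "n_rimE w s n \<longleftrightarrow> \<not> carpet (Suc x) y"
proof (cases "rev_col x y")
  case True
  then have "carpet (Suc x) y" using rev_row_N[of y x] carpet by (simp add: rev_col_def carpet_sym)
  then show ?thesis using True by (simp add: n_rimE_def rev_col_next)
next
  case nr: False
  show ?thesis
  proof (cases "x mod 6 = 5")
    case x5: True
    show ?thesis
    proof (cases "south_free x y")
      case True
      then have "carpet (Suc x) y" using west_free_N[of y x] carpet by (simp add: south_free_def carpet_sym)
      then show ?thesis using x5 nr True by (simp add: n_rimE_def digits_next rev_col_next s_None)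
    next
      case nw: False
      let ?x = "x div 6" and ?y = "y div 6"
      have P: "carpet x (y - 1)" by (simp add: pred_eqs nw)
      show ?thesis
      proof (cases "y mod 6 = 0")
        case y0: True
        have nw': "\<not> south_free ?x ?y" using nw south_free_rec[OF carpet] y0 by simp
        have "\<not> carpet (Suc (?y - 1)) (Suc ?x) \<longleftrightarrow>
            lookN (case_prod digits (corner_block (?y - 1) ?x)) (\<not> carpet (?y - 1) (Suc ?x))"
          using pred_eqs(2,4)[OF nw'] carpet_div[OF carpet] by (intro carpet_NE) (simp_all add: carpet_sym)
        moreover have "carpet (Suc x) y = carpet (Suc ?x) ?y" by (rule carpet_E5[OF carpet x5])
        moreover have "carpet (Suc x) (y - 1) = carpet (Suc ?x) (?y - 1)"
          using carpet_E5[OF P x5] y0 by (simp add: div6_pred)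
        moreover have "case_prod digits (corner_block (?y - 1) ?x) = prod.swap (case_prod digits (corner_block ?x (?y - 1)))"
          by (rule corner_block_swap_digits)
        ultimately show ?thesis
          using nr nw x5 y0 pred_eqs(2)[OF nw'] from_S_corner[OF y0 x5 nw]
          by (simp add: n_rimE_def digits_next rev_col_next s_None cN_eq state_def cpos_corner_own carpet_sym)
      next
        case False
        then have "carpet (Suc x) y = carpet (Suc x) (y - 1)"
          using carpet_E5[OF carpet x5] carpet_E5[OF P x5] by (simp add: div6_pred)
        then show ?thesis using False nr nw x5
          by (simp add: n_rimE_def digits_next rev_col_next s_None state_def)
      qed
    qed
  next
    case False
    then show ?thesis
      using carpet_E[OF carpet] carpet_hole[OF carpet] nr by (auto simp: n_rimE_def digits_next rev_col_next)
  qed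
qed

text \<open>On the level of cells the second content is a component of the state: it is read off row
  1 in (4,1) and handed up to (4,4).\<close>

lemma effective_next: "n_effective w s = effective x y"
proof (cases "digits x y = (4, 4)")
  case True
  then have "reads x y S" using rev_col_facts south_free_rec[OF carpet] by auto
  then show ?thesis using True
    by (simp add: n_effective_def digits_next state_def aux_def effective_rec[of x y] mod6_pred div6_pred)
next
  case False
  then show ?thesis by (auto simp: n_effective_def digits_next effective_rec[of x y])
qed

lemma E_next: "n_E w s e = send_E x y"
proof (cases "rev_row x y")
  case r: True
  then have f: "\<not> rev_col x y" "\<not> south_free x y" "y mod 6 = 5" using rev_row_facts by auto
  show ?thesis
  proof (cases "row_start x y")
    case True
    then have m: "x mod 6 = 5" "y mod 6 = 5" using row_start_mod by auto
    have "cN s = corner_own (x div 6) (y div 6)"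
      using f m by (simp add: cN_eq from_S_def wire_N.simps[of x "y - Suc 0"] mod6_pred div6_pred)
    then show ?thesis
      using True r row_start_send_E[OF carpet True] m unfolding n_E_def rev_row_next
      by (simp add: nbE_def wire_E.simps[of x y])
  next
    case False
    then have "rev_row (Suc x) y" using rev_row_E[OF carpet rev_row_not_start_E[OF carpet r False]] r by simp
    then show ?thesis
      using False r rev_block_E[OF carpet r False]
      unfolding n_E_def rev_row_next by (simp add: nbE_def state_def send_E_def row_own_def)
  qed
next
  case nr: False
  \<comment> \<open>A reversed column does not read the south. In column 5 the eastward gate
    consults it only at (5,5), where west and south agree.\<close>
  have "gate_E (effective x y) (from_W x y) Nul = gate_E (effective x y) (from_W x y) (from_S x y)" if c: "rev_col x y"
  proof -
    have m: "x mod 6 = 5" "\<not> west_free x y" using rev_col_facts c by auto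
    then have "effective x y = digits x y" by (simp add: effective_rec[of x y])
    moreover have "from_W x y = from_S x y" if "y mod 6 = 5" "from_S x y \<noteq> Nul"
      using m that by (simp add: from_W_def from_S_def wire_E.simps[of "x - Suc 0" y] wire_N.simps[of x "y - Suc 0"]
          mod6_pred div6_pred split: if_splits)
    ultimately show ?thesis using m by (auto simp: gate_E_def)
  qed
  then show ?thesis
    using nr wire_step[OF carpet] by (auto simp: n_E_def rev_row_next effective_next cE_eq cN_eq send_E_def)
qed

lemma N_next: "n_N w s n = send_N x y"
proof (cases "rev_col x y")
  case r: True
  then have f: "\<not> rev_row x y" "\<not> west_free x y" "x mod 6 = 5" using rev_col_facts by auto
  show ?thesis
  proof (cases "col_start x y")
    case True
    then have m: "x mod 6 = 5" "y mod 6 = 5" using col_start_mod by auto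
    have "cE w = corner_own (x div 6) (y div 6)"
      using f m by (simp add: cE_eq from_W_def wire_E.simps[of "x - Suc 0" y] mod6_pred div6_pred)
    then show ?thesis
      using True r col_start_send_N[OF carpet True] m unfolding n_N_def rev_col_next
      by (simp add: nbN_def wire_N.simps[of x y])
  next
    case False
    have a: "carpet y x" "rev_row y x" "\<not> row_start y x"
      using carpet r False by (auto simp: carpet_sym[of y x] rev_col_def col_start_def)
    have "rev_col x (Suc y)" using rev_row_E[OF a(1) rev_row_not_start_E[OF a]] a by (simp add: rev_col_def)
    then show ?thesis
      using False r rev_block_E[OF a]
      unfolding n_N_def rev_col_next by (simp add: nbN_def state_def send_N_def col_own_def)
  qed
next
  case nr: False
  \<comment> \<open>In row 5 the northward gate falls back on the west only at (5,5) without
    southern content, and column 5 always supplies such content here.\<close>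
  have "gate_N (effective x y) Nul (from_S x y) = gate_N (effective x y) (from_W x y) (from_S x y)" if c: "rev_row x y"
  proof -
    have m: "y mod 6 = 5" "\<not> south_free x y" using rev_row_facts c by auto
    then have "effective x y = digits x y" by (simp add: effective_rec[of x y])
    moreover have "from_S x y \<noteq> Nul" if "x mod 6 = 5"
      using m that by (simp add: from_S_def wire_N.simps[of x "y - Suc 0"] mod6_pred div6_pred)
    ultimately show ?thesis using m by (auto simp: gate_N_def)
  qed
  then show ?thesis
    using nr wire_step[OF carpet] by (auto simp: n_N_def rev_col_next effective_next cE_eq cN_eq send_N_def)
qed

lemma aux_next: "n_aux w s = aux x y"
proof -
  have a: "\<not> rev_row x y \<and> from_W x y = own (x div 6) (y div 6)" if d: "digits x y = (4, 1)"
  proof -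
    have "\<not> rev_row x y" "\<not> west_free x y" using d rev_row_facts west_free_rec[OF carpet] by auto
    then show ?thesis using d by (simp add: from_W_def wire_E.simps[of "x - Suc 0" y] mod6_pred div6_pred)
  qed
  have b: "the s = state x (y - 1)" if "digits x y = (4, 2) \<or> digits x y = (4, 3)"
  proof (rule the_s)
    have "\<not> south_free x y" using that south_free_mod[OF carpet] by auto
    moreover have "\<not> rev_col x y" using that rev_col_mod[of x y] by auto
    ultimately show "reads x y S" by simp
  qed
  show ?thesis
  proof (cases "digits x y = (4, 1) \<or> digits x y = (4, 2) \<or> digits x y = (4, 3)")
    case True
    then show ?thesis
      using a b unfolding n_aux_def digits_next cE_eq
      by (elim disjE) (simp_all add: aux_def state_def mod6_pred div6_pred)
  next
    case False
    then show ?thesis unfolding n_aux_def digits_next by (auto simp: aux_def)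
  qed
qed

lemma doubleN_next: "n_doubleN w s e n = doubleN x y"
proof -
  have r5: "rev_row x y \<Longrightarrow> send_E x y = row_own x y" by (simp add: send_E_def)
  have cr: "cpos (row_own x y) = case_prod digits (rev_block x y)" by (simp add: row_own_def split: prod.split)
  have ok: "starts_row (send_N x y) \<longleftrightarrow> starts (x div 6) (y div 6)"
    if "x mod 6 = 5" "y mod 6 = 4" "\<not> (rev_col x y \<and> \<not> col_start x y)"
  proof -
    have "\<not> rev_col x y" using that col_start_mod[of x y] by auto
    then show ?thesis
      using that starts_row_corner_own[OF carpet_div[OF carpet]] by (simp add: send_N_def wire_N.simps[of x y])
  qed
  have *: "n_doubleN w s e n \<longleftrightarrow> (carpet x (Suc y) \<and> \<not> (rev_col x y \<and> \<not> col_start x y)) \<and>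
    (if x mod 6 = 0 then
       if y mod 6 < 4 then west_free x y
       else if y mod 6 = 4 then west_free x y \<and> origin_block x y
       else if rev_row x y then west_free x y \<and> cpos (send_E x y) \<noteq> (4, 3)
       else w = None \<or> cpos (cE w) = (3, 1)
     else digits x y = (4, 1) \<or> digits x y = (4, 2) \<or> digits x y = (5, 4) \<and> starts_row (send_N x y))"
    unfolding n_doubleN_def digits_next prod.case rimN_next rev_col_next col_start_next west_free_next origin_block_next rev_row_next
      E_next N_next by blast
  have 0: "(if rev_row x y then west_free x y \<and> cpos (send_E x y) \<noteq> (4, 3) else w = None \<or> cpos (cE w) = (3, 1)) =
     (if rev_row x y then west_free x y \<and> case_prod digits (rev_block x y) \<noteq> (4, 3)
       else west_free x y \<or> case_prod digits (corner_block (x div 6 - 1) (y div 6)) = (3, 1))"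
    if "x mod 6 = 0" "\<not> y mod 6 < 4" "y mod 6 \<noteq> 4"
  proof -
    have "y mod 6 = 5" using that mod_less_divisor[of 6 y] by linarith
    then show ?thesis
      using that r5 cr from_W_corner by (cases "west_free x y") (simp_all add: w_None cE_eq cpos_corner_own)
  qed
  show ?thesis
    unfolding doubleN_iff[OF carpet] out_N_iff[OF carpet] * using 0 ok
    by (cases "x mod 6 = 0"; cases "y mod 6 < 4"; cases "y mod 6 = 4"; simp) blast+
qed

lemma doubleE_next: "n_doubleE w s e n = doubleN y x"
proof -
  have X: "carpet y x" using carpet by (simp add: carpet_sym)
  have rc: "rev_col y x = rev_row x y" "col_start y x = row_start x y" "rev_row y x = rev_col x y" "west_free y x = south_free x y"
    "origin_block y x = origin_block x y" by (auto simp: rev_col_def col_start_def south_free_def origin_block_def)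
  have r5: "rev_col x y \<Longrightarrow> send_N x y = col_own x y" by (simp add: send_N_def)
  have cr: "cpos (col_own x y) = prod.swap (case_prod digits (rev_block y x))"
    by (simp add: col_own_def split: prod.split)
  have cv: "case_prod digits (corner_block (y div 6 - 1) (x div 6)) = prod.swap (case_prod digits (corner_block (x div 6) (y div 6 - 1)))"
    by (rule corner_block_swap_digits)
  have sw: "prod.swap p = (a, b) \<longleftrightarrow> p = (b, a)" for p and a b :: nat by (cases p) auto
  have ok: "starts_col (send_E x y) \<longleftrightarrow> starts (y div 6) (x div 6)"
    if "y mod 6 = 5" "x mod 6 = 4" "\<not> (rev_row x y \<and> \<not> row_start x y)"
  proof -
    have "\<not> rev_row x y" using that row_start_mod[of x y] by auto
    then show ?thesis
      using that starts_col_corner_own[OF carpet_div[OF carpet]] by (simp add: send_E_def wire_E.simps[of x y])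
  qed
  have *: "n_doubleE w s e n \<longleftrightarrow> (carpet (Suc x) y \<and> \<not> (rev_row x y \<and> \<not> row_start x y)) \<and>
    (if y mod 6 = 0 then
       if x mod 6 < 4 then south_free x y
       else if x mod 6 = 4 then south_free x y \<and> origin_block x y
       else if rev_col x y then south_free x y \<and> cpos (send_N x y) \<noteq> (3, 4)
       else s = None \<or> cpos (cN s) = (1, 3)
     else digits x y = (1, 4) \<or> digits x y = (2, 4) \<or> digits x y = (4, 5) \<and> starts_col (send_E x y))"
    unfolding n_doubleE_def digits_next prod.case rimE_next rev_col_next row_start_next south_free_next origin_block_next rev_row_next
      E_next N_next by blast
  have 0: "(if rev_col x y then south_free x y \<and> cpos (send_N x y) \<noteq> (3, 4) else s = None \<or> cpos (cN s) = (1, 3)) =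
     (if rev_col x y then south_free x y \<and> case_prod digits (rev_block y x) \<noteq> (4, 3)
       else south_free x y \<or> case_prod digits (corner_block (y div 6 - 1) (x div 6)) = (3, 1))"
    if "y mod 6 = 0" "\<not> x mod 6 < 4" "x mod 6 \<noteq> 4"
  proof -
    have "x mod 6 = 5" using that mod_less_divisor[of 6 x] by linarith
    then show ?thesis
      using that r5 cr from_S_corner unfolding cv
      by (cases "south_free x y") (simp_all add: s_None cN_eq cpos_corner_own sw)
  qed
  show ?thesis
    unfolding doubleN_iff[OF X] out_N_iff[OF X] rc carpet_sym[of y "Suc x"] * using 0 ok
    by (cases "y mod 6 = 0"; cases "x mod 6 < 4"; cases "x mod 6 = 4"; simp) blast+
qed

lemma state_next: "state x y = next_state w s e n"
  by (simp add: state_def next_state_def digits_next origin_block_next west_free_next south_free_next rimN_next rimE_next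
      rev_row_next row_start_next rev_col_next col_start_next E_next N_next aux_next doubleN_next doubleE_next)

end

section \<open>The growth plan of the carpet\<close>

lemma K_iff: "i < 6 \<Longrightarrow> j < 6 \<Longrightarrow> (i, j) \<in> K \<longleftrightarrow> \<not> (i \<in> {2, 3} \<and> j \<in> {2, 3})"
  by (auto simp: K_def)

lemma sub_K: "sub_w K = 6" "sub_h K = 6"
proof -
  have "(i, 0) \<in> K" "(0, i) \<in> K" if "i \<le> 5" for i using that by (auto simp: K_def)
  then have "{0..5} \<subseteq> fst ` K" "{0..5} \<subseteq> snd ` K" by force+
  moreover have "fst ` K \<subseteq> {0..5}" "snd ` K \<subseteq> {0..5}" by (auto simp: K_def)
  ultimately have "fst ` K = {0..5}" "snd ` K = {0..5}" by auto
  moreover have "Max {0..5 :: nat} = 5" by (rule Max_eqI) auto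
  ultimately show "sub_w K = 6" "sub_h K = 6" by (simp_all add: sub_w_def sub_h_def)
qed

lemma G_pow_K: "(x, y) \<in> G_pow K k \<longleftrightarrow> carpet x y \<and> x < 6 ^ k \<and> y < 6 ^ k"
proof (induction k arbitrary: x y)
  case 0
  then show ?case by (auto simp: G_pow_def)
next
  case (Suc k)
  have "(x, y) \<in> G_pow K (Suc k) \<longleftrightarrow> (x div 6, y div 6) \<in> G_pow K k \<and> (x mod 6, y mod 6) \<in> K"
    by (simp add: G_pow_def sigma_def sub_K)
  then show ?case
    using carpet_rec[of x y] by (auto simp: Suc K_iff less_mult_imp_div_less div_less_iff_less_mult mult.commute)
qed

lemma G_inf_K: "G_inf K = {(x, y). carpet x y}"
proof -
  have "\<exists>k. x < 6 ^ k \<and> y < 6 ^ k" for x y :: nat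
  proof
    have "m < 6 ^ m" for m :: nat by (rule less_exp[THEN less_le_trans]) (simp add: power_mono)
    moreover have "(6 :: nat) ^ x \<le> 6 ^ (x + y)" "(6 :: nat) ^ y \<le> 6 ^ (x + y)"
      by (simp_all add: power_increasing)
    ultimately show "x < 6 ^ (x + y) \<and> y < 6 ^ (x + y)" by (meson less_le_trans)
  qed
  then show ?thesis by (auto simp: G_inf_def G_pow_K)
qed

lemma reads_set: "carpet x y \<Longrightarrow> x \<noteq> 0 \<or> y \<noteq> 0 \<Longrightarrow> {d. reads x y d} =
   (if rev_row x y then (if row_start x y then {S} else {S, E})
    else if rev_col x y then (if col_start x y then {W} else {W, N})
    else (if west_free x y then {} else {W}) \<union> (if south_free x y then {} else {S}))"
proof -
  assume a: "carpet x y" "x \<noteq> 0 \<or> y \<noteq> 0"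
  then interpret cell x y by unfold_locales
  show ?thesis
    using rev_row_facts rev_col_facts row_start_rev_row[of x y] col_start_rev_col[of x y]
    by (intro set_eqI, rename_tac d, case_tac d) auto
qed

lemma card_reads: "carpet x y \<Longrightarrow> x \<noteq> 0 \<or> y \<noteq> 0 \<Longrightarrow>
   card {d. reads x y d} = (if \<not> rev_row x y \<and> west_free x y \<or> \<not> rev_col x y \<and> south_free x y \<or> row_start x y \<or> col_start x y then 1 else 2)"
proof -
  assume a: "carpet x y" "x \<noteq> 0 \<or> y \<noteq> 0"
  then interpret cell x y by unfold_locales
  show ?thesis
    unfolding reads_set[OF a]
    using rev_row_facts rev_col_facts row_start_rev_row[of x y] col_start_rev_col[of x y] west_free_south_free[OF a(1)] a(2) by auto
qed

section \<open>A well-founded order of growth\<close>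

definition birth :: "nat \<Rightarrow> nat \<Rightarrow> nat" where
  "birth x y = weight x + weight y + (if rev_row x y then 2 * lag x y else 0) + (if rev_col x y then 2 * lag y x else 0)"

lemma birth_swap: "birth x y = birth y x"
  by (simp add: birth_def rev_col_def)

text \<open>A western neighbour on a reversed row is its undelayed start; on a reversed column its
  delay stays below the gap to the next column.\<close>

lemma birth_W:
  assumes "carpet x y" "\<not> rev_row x y" "\<not> west_free x y"
  shows "birth (x - 1) y < birth x y"
proof -
  have x: "Suc (x - 1) = x" "carpet (x - 1) y" using pred_eqs[of x y] assms(3) by auto
  then have "rev_row (x - 1) y \<Longrightarrow> lag (x - 1) y = 0"
    using rev_row_E[of "x - 1" y] assms row_start_lag[of "x - 1" y] by auto
  moreover have "weight (x - 1) + (if rev_col (x - 1) y then 2 * lag y (x - 1) else 0) < weight x"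
    using weight_less[of "x - 1"] lag_less[of y "x - 1"] x by (auto simp: rev_col_def)
  ultimately show ?thesis by (auto simp: birth_def)
qed

lemma birth_E:
  assumes "carpet x y" "rev_row x y" "\<not> row_start x y"
  shows "birth (Suc x) y < birth x y"
proof -
  have X: "carpet (Suc x) y" by (rule rev_row_not_start_E[OF assms])
  then have "rev_row (Suc x) y" using rev_row_E assms by blast
  then show ?thesis
    using assms rev_row_not_rev_col[OF X] rev_row_not_rev_col[OF assms(1)] lag_E[OF assms] weight_less[of x] by (simp add: birth_def)
qed

fun step :: "nat \<Rightarrow> nat \<Rightarrow> dir \<Rightarrow> nat \<times> nat" where
  "step x y W = (x - 1, y)" | "step x y S = (x, y - 1)" | "step x y E = (Suc x, y)" | "step x y N = (x, Suc y)"

lemma reads_step: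
  assumes "carpet x y" "reads x y d"
  shows "case_prod carpet (step x y d)" "case_prod birth (step x y d) < birth x y"
    "padd (int x, int y) (dvec d) = (int (fst (step x y d)), int (snd (step x y d)))"
proof -
  have Y: "carpet y x" using assms carpet_sym by blast
  show "case_prod carpet (step x y d)"
    using assms pred_eqs(3,4)[of x y] rev_row_not_start_E[of x y] rev_row_not_start_E[of y x] carpet_sym[of "Suc y" x] Y
    by (cases d) (auto simp: rev_col_def col_start_def)
  show "case_prod birth (step x y d) < birth x y"
    using assms birth_W[OF assms(1)] birth_E[OF assms(1)] birth_W[OF Y] birth_E[OF Y] birth_swap
    by (cases d) (auto simp: rev_col_def col_start_def south_free_def)
  show "padd (int x, int y) (dvec d) = (int (fst (step x y d)), int (snd (step x y d)))"
    using assms pred_eqs[of x y] by (cases d) (auto simp: padd_def west_free_def south_free_iff)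
qed

section \<open>Finiteness of the set of states\<close>

definition digit_pairs :: "(nat \<times> nat) set" where
  "digit_pairs = {..<6} \<times> {..<6}"

definition contents :: "content set" where
  "contents = {Nul, Turn} \<union> Ax ` digit_pairs \<union> (\<lambda>(r, w, s, b, e). Own r w s b e) ` (digit_pairs \<times> UNIV \<times> UNIV \<times> UNIV \<times> digit_pairs)"

lemma finite_contents: "finite contents"
  by (simp add: contents_def digit_pairs_def)

lemma digits_digit_pairs [simp]: "digits x y \<in> digit_pairs"
  by (simp add: digit_pairs_def)

lemma effective_digit_pairs [simp]: "effective x y \<in> digit_pairs"
proof (induction x y rule: digit_induct)
  case (digit x y)
  show ?case
  proof (cases "digits x y = (4, 4)")
    case True
    then have "y \<noteq> 0" by (cases "y = 0") auto
    then show ?thesis using digit True by (simp add: effective_rec[of x y])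
  next
    case False
    then show ?thesis unfolding effective_rec[of x y] by (simp only: if_False digits_digit_pairs)
  qed
qed

lemma contents_simps [simp]: "Nul \<in> contents" "Turn \<in> contents" "Ax r \<in> contents \<longleftrightarrow> r \<in> digit_pairs"
  "Own r w s b e \<in> contents \<longleftrightarrow> r \<in> digit_pairs \<and> e \<in> digit_pairs"
  by (auto simp: contents_def image_iff)

lemma own_contents [simp]: "own x y \<in> contents" "set_effective (effective a b) (own x y) \<in> contents" "corner_own x y \<in> contents"
    "row_own x y \<in> contents" "col_own x y \<in> contents" "aux x y \<in> contents"
  by (auto simp: own_def corner_own_def row_own_def col_own_def aux_def split: prod.split)

lemma wire_E_contents [simp]: "wire_E x y \<in> contents"
proof (induction x y rule: wire_E.induct)
  case (1 x y)
  then show ?case by (subst wire_E.simps) (auto simp: Let_def)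
qed

lemma wire_N_contents [simp]: "wire_N x y \<in> contents"
proof (induction x y rule: wire_N.induct)
  case (1 x y)
  then show ?case by (subst wire_N.simps) (auto simp: Let_def)
qed

lemma finite_states: "finite (range (case_prod state))"
proof (rule finite_subset)
  let ?B = "UNIV :: bool set"
  let ?f = "\<lambda>(r, o', a, b, c, d, e, f, g, h, cE, cN, cA, i, j). St r o' a b c d e f g h cE cN cA i j"
  let ?A = "digit_pairs \<times> ?B \<times> ?B \<times> ?B \<times> ?B \<times> ?B \<times> ?B \<times> ?B \<times> ?B \<times> ?B \<times> contents \<times> contents \<times> contents \<times> ?B \<times> ?B"
  have "state x y \<in> ?f ` ?A" for x y
    by (rule image_eqI[of _ _ "(digits x y, origin_block x y, west_free x y, south_free x y, \<not> carpet x (Suc y), \<not> carpet (Suc x) y,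
     rev_row x y, row_start x y, rev_col x y, col_start x y, send_E x y, send_N x y, aux x y, doubleN x y, doubleN y x)"])
      (simp_all add: state_def send_E_def send_N_def)
  then show "range (case_prod state) \<subseteq> ?f ` ?A" by auto
  show "finite (?f ` ?A)" by (intro finite_imageI finite_cartesian_product) (simp_all add: finite_contents digit_pairs_def)
qed

definition cells :: "pos set" where
  "cells = {(int x, int y) | x y. carpet x y}"

definition inputs :: "pos \<Rightarrow> dir set" where
  "inputs z = {d. reads (nat (fst z)) (nat (snd z)) d}"

lemma cells_iff: "(a, b) \<in> cells \<longleftrightarrow> 0 \<le> a \<and> 0 \<le> b \<and> carpet (nat a) (nat b)"
  unfolding cells_def by auto (metis nat_0_le)

lemma cells_int [simp]: "(int x, int y) \<in> cells \<longleftrightarrow> carpet x y"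
  by (simp add: cells_iff)

lemma inputs_int [simp]: "inputs (int x, int y) = {d. reads x y d}"
  by (simp add: inputs_def)

text \<open>To the south and west the strength is always 1, because a cell on a reversed line other
  than its start has exactly two inputs.\<close>

fun out_of :: "cell_state \<Rightarrow> dir \<Rightarrow> nat" where
  "out_of u N = (if \<not> s_rimN u \<and> \<not> (s_rev_col u \<and> \<not> s_col_start u) then (if s_doubleN u then 2 else 1) else 0)"
| "out_of u E = (if \<not> s_rimE u \<and> \<not> (s_rev_row u \<and> \<not> s_row_start u) then (if s_doubleE u then 2 else 1) else 0)"
| "out_of u S = (if s_rev_col u \<and> \<not> s_south_free u then 1 else 0)"
| "out_of u W = (if s_rev_row u \<and> \<not> s_west_free u then 1 else 0)"

lemma out_int:
  "padd z (dvec d) = (int a, int b) \<Longrightarrow> out_strength cells inputs z d =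
     (if carpet a b \<and> reads a b (opp d) then 2 div card {d. reads a b d} else 0)"
  by (simp add: out_strength_def)

lemma strength_N:
  assumes "carpet x y"
  shows "out_strength cells inputs (int x, int y) N = out_of (state x y) N"
proof -
  have z: "padd (int x, int y) (dvec N) = (int x, int (Suc y))" by (simp add: padd_def)
  have "2 div card {d. reads x (Suc y) d} = (if doubleN x y then 2 else 1)"
    if "carpet x (Suc y)" "\<not> rev_col x (Suc y)"
    using that card_reads[OF that(1)] assms col_start_rev_col[of x "Suc y"] by (auto simp: doubleN_def out_N_def)
  then show ?thesis
    using rev_col_N[OF assms] assms unfolding out_int[OF z] by (auto simp: state_def)
qed

lemma strength_E:
  assumes "carpet x y"
  shows "out_strength cells inputs (int x, int y) E = out_of (state x y) E"
proof -
  have z: "padd (int x, int y) (dvec E) = (int (Suc x), int y)" by (simp add: padd_def)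
  have "2 div card {d. reads (Suc x) y d} = (if doubleN y x then 2 else 1)"
    if "carpet (Suc x) y" "\<not> rev_row (Suc x) y"
    using that card_reads[OF that(1)] assms row_start_rev_row[of "Suc x" y] carpet_sym[of "Suc x" y]
    by (auto simp: doubleN_def out_N_def rev_col_def col_start_def south_free_def)
  then show ?thesis
    using rev_row_E[OF assms] assms unfolding out_int[OF z] by (auto simp: state_def)
qed

lemma strength_W:
  assumes "carpet x y"
  shows "out_strength cells inputs (int x, int y) W = out_of (state x y) W"
proof (cases "west_free x y")
  case True
  then have "padd (int x, int y) (dvec W) \<notin> cells"
    by (auto simp: padd_def west_free_def cells_iff nat_diff_distrib')
  then show ?thesis using True by (simp add: out_strength_def state_def)
next
  case False
  then have z: "padd (int x, int y) (dvec W) = (int (x - 1), int y)" by (auto simp: padd_def west_free_def)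
  have x: "Suc (x - 1) = x" "carpet (x - 1) y" using pred_eqs[of x y] False by auto
  have r: "rev_row x y \<longleftrightarrow> rev_row (x - 1) y \<and> \<not> row_start (x - 1) y" using rev_row_E[OF x(2)] x assms by simp
  have "card {d. reads (x - 1) y d} = 2" if "rev_row x y"
  proof -
    have y: "y mod 6 = 5" using that by (rule rev_row_mod)
    show ?thesis
      using that r y card_reads[OF x(2) mod6_5_nz[OF y]] rev_row_not_rev_col[OF x(2)] col_start_rev_col[of "x - 1" y] south_free_mod[OF x(2)]
      by auto
  qed
  then show ?thesis using False r x unfolding out_int[OF z] by (auto simp: state_def)
qed

lemma strength_S:
  assumes "carpet x y"
  shows "out_strength cells inputs (int x, int y) S = out_of (state x y) S"
proof (cases "south_free x y")
  case True
  then have "padd (int x, int y) (dvec S) \<notin> cells"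
    by (auto simp: padd_def south_free_iff cells_iff nat_diff_distrib')
  then show ?thesis using True by (simp add: out_strength_def state_def)
next
  case False
  then have z: "padd (int x, int y) (dvec S) = (int x, int (y - 1))" by (auto simp: padd_def south_free_iff)
  have y: "Suc (y - 1) = y" "carpet x (y - 1)" using pred_eqs[of x y] False by auto
  have r: "rev_col x y \<longleftrightarrow> rev_col x (y - 1) \<and> \<not> col_start x (y - 1)" using rev_col_N[OF y(2)] y assms by simp
  have "card {d. reads x (y - 1) d} = 2" if "rev_col x y"
  proof -
    have x: "x mod 6 = 5" using that by (rule rev_col_mod)
    show ?thesis
      using that r x card_reads[OF y(2)] mod6_5_nz[OF x, of "y - 1"] rev_row_not_rev_col[OF y(2)] row_start_rev_row[of x "y - 1"]
        west_free_mod[OF y(2)]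
      by auto
  qed
  then show ?thesis using False r y unfolding out_int[OF z] by (auto simp: state_def)
qed

lemma out_of_state: "carpet x y \<Longrightarrow> out_strength cells inputs (int x, int y) = out_of (state x y)"
  using strength_N strength_E strength_S strength_W by (intro ext, rename_tac d, case_tac d) blast+

definition state_at :: "pos \<Rightarrow> cell_state" where
  "state_at z = state (nat (fst z)) (nat (snd z))"

lemma state_int [simp]: "state_at (int x, int y) = state x y"
  by (simp add: state_at_def)

lemma state_determined:
  assumes X: "carpet x y" "x \<noteq> 0 \<or> y \<noteq> 0" "carpet x' y'" "x' \<noteq> 0 \<or> y' \<noteq> 0"
    and I: "\<And>d. reads x y d = reads x' y' d"
    and s: "\<And>d. reads x y d \<Longrightarrow> case_prod state (step x y d) = case_prod state (step x' y' d)"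
  shows "state x y = state x' y'"
proof -
  have "nbW x y = nbW x' y'" "nbS x y = nbS x' y'" "nbE x y = nbE x' y'" "nbN x y = nbN x' y'"
    using I[of W] s[of W] I[of S] s[of S] I[of E] s[of E] I[of N] s[of N]
    unfolding nbW_def nbS_def nbE_def nbN_def opt_def step.simps prod.case by auto
  moreover have "cell x y" "cell x' y'" using X by (auto simp: cell_def)
  ultimately show ?thesis by (metis cell.state_next)
qed

interpretation plan: growth_plan cells "(0, 0)" inputs state_at
  "\<lambda>z. birth (nat (fst z)) (nat (snd z))"
proof
  show "(0, 0) \<in> cells" by (simp add: cells_iff)
  show "inputs (0, 0) = {}"
  proof -
    have "reads 0 0 d \<longleftrightarrow> False" for d
      using rev_row_mod[of 0 0] by (cases d) (auto simp: rev_col_def west_free_def south_free_def)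
    then show ?thesis by (simp add: inputs_def)
  qed
  show "finite (state_at ` cells)"
    by (rule finite_subset[OF _ finite_states]) (auto simp: state_at_def)
  fix z
  assume z: "z \<in> cells"
  then obtain x y where xy: "z = (int x, int y)" "carpet x y" by (auto simp: cells_def)
  show "z \<noteq> (0, 0) \<Longrightarrow> card (inputs z) = 1 \<or> card (inputs z) = 2"
    using card_reads[OF xy(2)] by (auto simp: xy(1))
  fix d
  assume d: "d \<in> inputs z"
  then have "reads x y d" by (simp add: xy(1))
  note cell_state = reads_step[OF xy(2) this]
  show "padd z (dvec d) \<in> cells"
    using cell_state(1) by (simp add: xy(1) cell_state(3) split: prod.splits)
  show "birth (nat (fst (padd z (dvec d)))) (nat (snd (padd z (dvec d)))) < birth (nat (fst z)) (nat (snd z))"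
    using cell_state(2) by (simp add: xy(1) cell_state(3) split: prod.splits)
next
  fix z z'
  assume z: "z \<in> cells" and z': "z' \<in> cells"
  obtain x y where xy: "z = (int x, int y)" "carpet x y" using z by (auto simp: cells_def)
  obtain x' y' where xy': "z' = (int x', int y')" "carpet x' y'" using z' by (auto simp: cells_def)
  show "state_at z = state_at z' \<Longrightarrow> out_strength cells inputs z = out_strength cells inputs z'"
    using out_of_state[OF xy(2)] out_of_state[OF xy'(2)] by (simp add: xy(1) xy'(1))
  assume nz: "z \<noteq> (0, 0)" "z' \<noteq> (0, 0)" and I: "inputs z = inputs z'"
    and s: "\<forall>d\<in>inputs z. state_at (padd z (dvec d)) = state_at (padd z' (dvec d))"
  have I': "reads x y d = reads x' y' d" for d using I by (auto simp: xy(1) xy'(1))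
  have "case_prod state (step x y d) = case_prod state (step x' y' d)" if d: "reads x y d" for d
  proof -
    have "reads x' y' d" using d I' by simp
    moreover have "state_at (padd z (dvec d)) = state_at (padd z' (dvec d))" using s d by (simp add: xy(1))
    ultimately show ?thesis
      using reads_step(3)[OF xy(2) d] reads_step(3)[OF xy'(2), of d]
      unfolding xy(1) xy'(1) by (simp add: case_prod_beta)
  qed
  then show "state_at z = state_at z'"
    using state_determined[OF xy(2) _ xy'(2) _ I'] nz by (simp add: xy(1) xy'(1))
qed

theorem mainTheorem1:
  shows "\<exists>\<T>. valid_tas \<T> \<and> temp \<T> = 2 \<and>
             strictly_self_assembles \<T> (to_pos ` G_inf K)"
proof -
  have "to_pos ` G_inf K = cells" by (force simp: G_inf_K cells_def to_pos_def image_iff)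
  then show ?thesis using plan.strictly_assembles by auto
qed

end
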